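(* Let $-\infty\le a<b\le\infty$, let $\alpha,\beta,s$ be positive numbers, and let $f,g\in\mathfrak{M}^{+}$ be such that $F(y):=\int_y^b f(t)\,dt<\infty$ and $G(y):=\int_a^y g(t)\,dt<\infty$ for every $y\in(a,b)$. Then for every $x\in(a,b)$ the following hold (where $\inf_{h\ge 0}$ denotes the infimum over all $h\in\mathfrak{M}^+$): (i) $\displaystyle\sup_{x<y<b}F^{\alpha}(y)G^{\beta}(y)\approx\sup_{x<y<b}\left(\int_y^b f(t)G^{\frac{\beta-s}{\alpha}}(t)\,dt\right)^{\alpha}G^{s}(y)$; (ii) $\displaystyle\sup_{x<y<b}F^{\alpha}(y)G^{\beta}(y)\approx\sup_{x<y<b}\left(\int_x^y f(t)G^{\frac{\beta+s}{\alpha}}(t)\,dt\right)^{\alpha}G^{-s}(y)$; (iii) $\displaystyle\sup_{x<y<b}F^{\alpha}(y)G^{\beta}(y)\approx\sup_{x<y<b}\left(\int_y^b f(t)G^{\frac{\beta}{\alpha+s}}(t)\,dt\right)^{\alpha+s}F^{-s}(y)$; (iv) if $\alpha>s$: $\displaystyle\sup_{x<y<b}F^{\alpha}(y)G^{\beta}(y)\approx\sup_{x<y<b}\left(\int_x^y f(t)G^{\frac{\beta}{\alpha-s}}(t)\,dt\right)^{\alpha-s}F^{s}(y)$; (v) if $\alpha<s$: $\displaystyle\sup_{x<y<b}F^{\alpha}(y)G^{\beta}(y)\approx\sup_{x<y<b}\left(\int_y^b f(t)G^{\frac{\beta}{\alpha-s}}(t)\,dt\right)^{\alpha-s}F^{s}(y)$;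 (vi) if $\beta<s$: $\displaystyle\sup_{x<y<b}F^{\alpha}(y)G^{\beta}(y)\approx\inf_{h\ge0}\sup_{x<y<b}\left(\int_y^b f(t)h^{\frac{\beta-s}{\alpha}}(t)\,dt\right)^{\alpha}\big(h(y)+G(y)\big)^{s}$; (vii) $\displaystyle\sup_{x<y<b}F^{\alpha}(y)G^{\beta}(y)\approx\inf_{h\ge0}\sup_{x<y<b}h(y)^{-s}\left(\int_x^y f(z)\big(h(z)+G(z)\big)^{\frac{\beta+s}{\alpha}}\,dz\right)^{\alpha}$; (viii) $\displaystyle\sup_{a<y<x}F^{\alpha}(y)G^{\beta}(y)\approx\sup_{a<y<x}\left(\int_a^y g(t)F^{\frac{\alpha-s}{\beta}}(t)\,dt\right)^{\beta}F^{s}(y)$; (ix) $\displaystyle\sup_{a<y<x}F^{\alpha}(y)G^{\beta}(y)\approx\sup_{a<y<x}\left(\int_y^x g(t)F^{\frac{\alpha+s}{\beta}}(t)\,dt\right)^{\beta}F^{-s}(y)$; (x) $\displaystyle\sup_{a<y<x}F^{\alpha}(y)G^{\beta}(y)\approx\sup_{a<y<x}\left(\int_a^y g(t)F^{\frac{\alpha}{\beta+s}}(t)\,dt\right)^{\beta+s}G^{-s}(y)$; (xi) if $\beta>s$: $\displaystyle\sup_{a<y<x}F^{\alpha}(y)G^{\beta}(y)\approx\sup_{a<y<x}\left(\int_y^x g(t)F^{\frac{\alpha}{\beta-s}}(t)\,dt\right)^{\beta-s}G^{s}(y)$; (xii) if $\beta<s$: $\displaystyle\sup_{a<y<x}F^{\alpha}(y)G^{\beta}(y)\approx\sup_{a<y<x}\left(\int_a^y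 g(t)F^{\frac{\alpha}{\beta-s}}(t)\,dt\right)^{\beta-s}G^{s}(y)$; (xiii) if $\alpha<s$: $\displaystyle\sup_{a<y<x}F^{\alpha}(y)G^{\beta}(y)\approx\inf_{h\ge0}\sup_{a<y<x}\left(\int_a^y g(t)h^{\frac{\alpha-s}{\beta}}(t)\,dt\right)^{\beta}\big(h(y)+F(y)\big)^{s}$; (xiv) $\displaystyle\sup_{a<y<x}F^{\alpha}(y)G^{\beta}(y)\approx\inf_{h\ge0}\sup_{a<y<x}h(y)^{-s}\left(\int_y^x g(z)\big(h(z)+F(z)\big)^{\frac{\alpha+s}{\beta}}\,dz\right)^{\beta}$.
   Context: $\mathfrak{M}^{+}$ is the set of non-negative (real-valued) Lebesgue measurable functions on $(a,b)$. For quantities $A,B\in[0,\infty]$, $A\approx B$ means $c_1A\le B\le c_2A$ with positive finite constants $c_1,c_2$ depending only on $\alpha,\beta,s$ (in particular independent of $x$, $f$, $g$). Expressions are evaluated in $[0,\infty]$, with $0\cdot\infty=0$, and with $0^{r}=\infty$, $\infty^{r}=0$ for $r<0$. *)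

theory Defs
  imports "HOL-Analysis.Analysis"
begin

text \<open>
  Real powers on the extended half-line, with \<open>0 powe r = \<infinity>\<close> and \<open>\<infinity> powe r = 0\<close> for
  \<open>r < 0\<close>.  The exponent \<open>0\<close> is treated separately because \<open>0 powr 0 = 0\<close> for the
  library's \<open>powr\<close>, whereas here \<open>x powe 0 = 1\<close> for every \<open>x\<close>.  The product of
  \<^typ>\<open>ennreal\<close> already satisfies \<open>0 * \<infinity> = 0\<close>.
\<close>

definition epowr :: "ennreal \<Rightarrow> real \<Rightarrow> ennreal"  (infixr \<open>powe\<close> 80) where
  "x powe r =
    (if r = 0 then 1
     else if x = 0 then (if r > 0 then 0 else top)
     else if x = top then (if r > 0 then top else 0)
     else ennreal (enn2real x powr r))"

lemma powe_ennreal: "t > 0 \<Longrightarrow> ennreal t powe r = ennreal (t powr r)"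
  by (simp add: epowr_def)

lemma zero_powe: "r > 0 \<Longrightarrow> 0 powe r = 0" "r < 0 \<Longrightarrow> 0 powe r = top"
  by (simp_all add: epowr_def)

lemma top_powe: "r > 0 \<Longrightarrow> top powe r = top" "r < 0 \<Longrightarrow> top powe r = 0"
  by (simp_all add: epowr_def)

text \<open>
  Functions on \<open>(a, b)\<close> are represented by total functions whose values outside
  \<open>(a, b)\<close> are irrelevant.
\<close>

definition Mplus :: "ereal \<Rightarrow> ereal \<Rightarrow> (real \<Rightarrow> real) set" where
  "Mplus a b = {h. h \<in> borel_measurable (lebesgue_on (einterval a b)) \<and>
                   (\<forall>t\<in>einterval a b. 0 \<le> h t)}"

definition upper_int :: "ereal \<Rightarrow> (real \<Rightarrow> real) \<Rightarrow> real \<Rightarrow> ennreal" where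
  "upper_int b f y = (\<integral>\<^sup>+ t\<in>einterval (ereal y) b. ennreal (f t) \<partial>lebesgue)"

definition lower_int :: "ereal \<Rightarrow> (real \<Rightarrow> real) \<Rightarrow> real \<Rightarrow> ennreal" where
  "lower_int a g y = (\<integral>\<^sup>+ t\<in>einterval a (ereal y). ennreal (g t) \<partial>lebesgue)"

definition admissible ::
    "ereal \<Rightarrow> ereal \<Rightarrow> (real \<Rightarrow> real) \<Rightarrow> (real \<Rightarrow> real) \<Rightarrow> real \<Rightarrow> bool" where
  "admissible a b f g x \<longleftrightarrow>
     a < b \<and> f \<in> Mplus a b \<and> g \<in> Mplus a b \<and>
     (\<forall>y\<in>einterval a b. upper_int b f y < top \<and> lower_int a g y < top) \<and>
     x \<in> einterval a b"

text \<open>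
  The relation \<open>\<approx>\<close>: the two quantities are viewed as functions of the data \<open>a b f g x\<close>,
  and the constants are chosen before these data, so they can only depend on what is
  fixed outside (namely \<open>\<alpha>\<close>, \<open>\<beta>\<close> and \<open>s\<close>).
\<close>

definition equivalent ::
    "(ereal \<Rightarrow> ereal \<Rightarrow> (real \<Rightarrow> real) \<Rightarrow> (real \<Rightarrow> real) \<Rightarrow> real \<Rightarrow> ennreal) \<Rightarrow>
     (ereal \<Rightarrow> ereal \<Rightarrow> (real \<Rightarrow> real) \<Rightarrow> (real \<Rightarrow> real) \<Rightarrow> real \<Rightarrow> ennreal) \<Rightarrow> bool" where
  "equivalent A B \<longleftrightarrow>
     (\<exists>c1 c2 :: real. c1 > 0 \<and> c2 > 0 \<and>
        (\<forall>a b f g x. admissible a b f g x \<longrightarrow>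
           ennreal c1 * A a b f g x \<le> B a b f g x \<and>
           B a b f g x \<le> ennreal c2 * A a b f g x))"

definition sup_right :: "real \<Rightarrow> real \<Rightarrow>
    ereal \<Rightarrow> ereal \<Rightarrow> (real \<Rightarrow> real) \<Rightarrow> (real \<Rightarrow> real) \<Rightarrow> real \<Rightarrow> ennreal" where
  "sup_right \<alpha> \<beta> a b f g x =
     (SUP y\<in>einterval (ereal x) b. upper_int b f y powe \<alpha> * lower_int a g y powe \<beta>)"

definition sup_left :: "real \<Rightarrow> real \<Rightarrow>
    ereal \<Rightarrow> ereal \<Rightarrow> (real \<Rightarrow> real) \<Rightarrow> (real \<Rightarrow> real) \<Rightarrow> real \<Rightarrow> ennreal" where
  "sup_left \<alpha> \<beta> a b f g x =
     (SUP y\<in>einterval a (ereal x). upper_int b f y powe \<alpha> * lower_int a g y powe \<beta>)"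

end

theory Submission
  imports Defs
begin

text \<open>
  Put the measure \<open>f dt\<close> on \<open>(x, b)\<close>. Since it has no atoms, the set where its tail \<open>F\<close> is at most
  \<open>c\<close> has measure at most \<open>c\<close>. Summing over dyadic level sets, the integrals of \<open>F powe (- \<kappa>)\<close> are
  therefore controlled as if \<open>F\<close> were the variable of integration: by \<open>F(y) powe (1 - \<kappa>)\<close> over
  \<open>(y, b)\<close> for \<open>\<kappa> < 1\<close> and over \<open>(x, y)\<close> for \<open>\<kappa> > 1\<close>. If \<open>S\<close> is the supremum of
  \<open>F powe \<alpha> * G powe \<beta>\<close>, then \<open>G powe \<beta> \<le> S * F powe (- \<alpha>)\<close> pointwise, and inserting this in the
  integrals on the right-hand sides bounds them by \<open>S\<close>. The converse bounds follow from the
  monotonicity of \<open>G\<close> or, in (i) for \<open>\<beta> < s\<close>, (ii), (vi) and (vii), from the same argument applied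
  to the measure whose density is the integrand. Reflection at \<open>0\<close> swaps the roles of \<open>F\<close> and \<open>G\<close>
  and gives (viii)--(xiv).
\<close>

subsection \<open>Extended real powers\<close>

text \<open>Formally \<open>f dt = - dF\<close>, which would reduce everything to integrating
  powers. But F may be constant on intervals and vanish before b, and negative powers take the
  values 0 and \<infinity>; the single bound "measure of \<open>F \<le> c\<close> is at most c"
  replaces the substitution. At c = 0 it says that F is positive almost everywhere for
  \<open>f dt\<close>, which is what allows dividing by powers of F.

  Two points need more than this. In (ii), the integral of F^(-\<kappa>) over (x, y) would leave a
  negative power of F(y)^\<alpha> G(y)^\<beta>, which S does not bound; so the minimum of that bound
  with the one from G(t) \<le> G(y) is integrated. In (vi) and (vii), h need not be monotone. The
  integral involving h is then itself read as a tail of a new measure, the assumed bound R controls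
  h by a power of that tail, and F is recovered by integrating the reciprocal weight against the new
  measure. The lower bounds in (ii), and in (i) for \<beta> < s, are the case h = G; the powers of 2
  come from h + G = 2 G.\<close>

lemma ennreal_zero_pos_top_cases:
  fixes x :: ennreal
  obtains (zero) "x = 0" | (pos) r where "r > 0" "x = ennreal r" | (top) "x = top"
  by (cases x) (metis ennreal_0 less_eq_real_def)+

lemma powe_0 [simp]: "x powe 0 = 1"
  by (simp add: epowr_def)

lemma powe_1 [simp]: "x powe 1 = x"
  by (cases x rule: ennreal_zero_pos_top_cases) (simp_all add: zero_powe top_powe powe_ennreal)

lemma one_powe [simp]: "1 powe r = 1"
  using powe_ennreal[of 1 r] by simp

lemma powe_eq_0_iff: "x powe r = 0 \<longleftrightarrow> (x = 0 \<and> r > 0) \<or> (x = top \<and> r < 0)"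
  by (cases x rule: ennreal_zero_pos_top_cases; cases r "0::real" rule: linorder_cases)
     (simp_all add: zero_powe top_powe powe_ennreal)

lemma powe_eq_top_iff: "x powe r = top \<longleftrightarrow> (x = 0 \<and> r < 0) \<or> (x = top \<and> r > 0)"
  by (cases x rule: ennreal_zero_pos_top_cases; cases r "0::real" rule: linorder_cases)
     (simp_all add: zero_powe top_powe powe_ennreal)

lemma powe_mono:
  assumes "x \<le> y" "0 \<le> r"
  shows "x powe r \<le> y powe r"
proof (cases "r = 0")
  case False
  with assms have "r > 0" by simp
  with \<open>x \<le> y\<close> show ?thesis
    by (cases x rule: ennreal_zero_pos_top_cases; cases y rule: ennreal_zero_pos_top_cases)
       (auto simp: zero_powe top_powe powe_ennreal top_unique intro!: ennreal_leI powr_mono2)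
qed simp

lemma powe_antimono:
  assumes "x \<le> y" "r \<le> 0"
  shows "y powe r \<le> x powe r"
proof (cases "r = 0")
  case False
  with assms have "r < 0" by simp
  with \<open>x \<le> y\<close> show ?thesis
    by (cases x rule: ennreal_zero_pos_top_cases; cases y rule: ennreal_zero_pos_top_cases)
       (auto simp: zero_powe top_powe powe_ennreal top_unique intro!: ennreal_leI powr_mono2')
qed simp

lemma powe_powe: "(x powe r) powe q = x powe (r * q)"
proof (cases x rule: ennreal_zero_pos_top_cases)
  case (pos t)
  then show ?thesis by (simp add: powe_ennreal powr_powr)
next
  case zero
  then show ?thesis
    by (cases r "0::real" rule: linorder_cases; cases q "0::real" rule: linorder_cases)
       (simp_all add: zero_powe top_powe mult_pos_pos mult_neg_neg mult_pos_neg mult_neg_pos)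
next
  case top
  then show ?thesis
    by (cases r "0::real" rule: linorder_cases; cases q "0::real" rule: linorder_cases)
       (simp_all add: zero_powe top_powe mult_pos_pos mult_neg_neg mult_pos_neg mult_neg_pos)
qed

lemma powe_mult:
  assumes "0 \<le> r"
  shows "(x * y) powe r = x powe r * y powe r"
proof (cases "r = 0")
  case False
  with assms have "r > 0" by simp
  then show ?thesis
    by (cases x rule: ennreal_zero_pos_top_cases; cases y rule: ennreal_zero_pos_top_cases)
       (auto simp: zero_powe top_powe powe_ennreal powr_mult ennreal_mult_top ennreal_top_mult
          simp flip: ennreal_mult)
qed simp

text \<open>A negative power of a product splits only if one factor is positive and finite: for x =
  0, y = \<open>top\<close> and r < 0 the left side would be \<open>top\<close>, but the right side
  \<open>top * 0 = 0\<close>.\<close>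

lemma powe_mult_pos:
  assumes "0 < x" "x < top"
  shows "(x * y) powe r = x powe r * y powe r"
proof -
  obtain t where "t > 0" "x = ennreal t"
    using assms by (cases x rule: ennreal_zero_pos_top_cases) auto
  then show ?thesis
    by (cases y rule: ennreal_zero_pos_top_cases; cases r "0::real" rule: linorder_cases)
       (auto simp: zero_powe top_powe powe_ennreal powr_mult ennreal_mult_top ennreal_top_mult
          simp flip: ennreal_mult)
qed

lemma powe_add:
  assumes "0 < x" "x < top"
  shows "x powe (r + q) = x powe r * x powe q"
  using assms by (cases x rule: ennreal_zero_pos_top_cases)
    (auto simp: powe_ennreal powr_add simp flip: ennreal_mult)

lemma powe_add_nonneg:
  assumes "0 \<le> r" "0 \<le> q"
  shows "x powe (r + q) = x powe r * x powe q"
  using assms by (cases x rule: ennreal_zero_pos_top_cases; cases "r = 0"; cases "q = 0")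
    (auto simp: powe_ennreal powr_add zero_powe top_powe simp flip: ennreal_mult)

text \<open>At 0 and \<open>top\<close>, exponents of opposite sign give a product 0, so equality
  can fail but this direction survives. It settles the degenerate points in the upper bounds without
  a case distinction.\<close>

lemma powe_add_le: "x powe r * x powe q \<le> x powe (r + q)"
proof (cases x rule: ennreal_zero_pos_top_cases)
  case (pos t)
  then show ?thesis by (simp add: powe_add)
next
  case zero
  then show ?thesis
    by (cases r "0::real" rule: linorder_cases; cases q "0::real" rule: linorder_cases)
       (simp_all add: zero_powe)
next
  case top
  then show ?thesis
    by (cases r "0::real" rule: linorder_cases; cases q "0::real" rule: linorder_cases)
       (simp_all add: top_powe)
qed

lemma powe_neg_cancel:
  assumes "0 < x" "x < top"
  shows "x powe r * x powe (- r) = 1" "x powe (- r) * x powe r = 1"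
  using powe_add[OF assms, of r "- r"] powe_add[OF assms, of "- r" r] by simp_all

lemma powe_cancel_le: "x powe (- r) * x powe r \<le> 1" "x powe r * x powe (- r) \<le> 1"
  using powe_add_le[of x "- r" r] powe_add_le[of x r "- r"] by simp_all

lemma powe_split_1:
  assumes "0 \<le> p" "0 \<le> q" "p + q = 1"
  shows "x powe p * x powe q = x"
  using powe_add_nonneg[OF assms(1,2), of x] assms(3) by simp

lemma powe_pos_finite:
  assumes "0 < x" "x < top"
  shows "0 < x powe r" "x powe r < top"
  using assms by (auto simp: powe_eq_top_iff powe_eq_0_iff zero_less_iff_neq_zero simp flip: less_top)

lemma measurable_powe [measurable (raw)]:
  assumes [measurable]: "h \<in> borel_measurable M"
  shows "(\<lambda>t. h t powe r) \<in> borel_measurable M"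
  unfolding epowr_def by measurable

lemma powe_le_of_mult_le:
  assumes "x powe \<alpha> * y powe \<beta> \<le> B" "0 < x" "x < top" "0 < \<beta>" "0 \<le> r"
  shows "y powe r \<le> B powe (r / \<beta>) * x powe (- (\<alpha> * r / \<beta>))"
proof -
  have "y powe \<beta> = x powe (- \<alpha>) * (x powe \<alpha> * y powe \<beta>)"
    using powe_neg_cancel[OF assms(2,3), of \<alpha>] by (simp add: mult.assoc[symmetric])
  also have "\<dots> \<le> x powe (- \<alpha>) * B"
    using assms(1) by (rule mult_left_mono) simp
  finally have "(y powe \<beta>) powe (r / \<beta>) \<le> (x powe (- \<alpha>) * B) powe (r / \<beta>)"
    using assms by (intro powe_mono) auto
  then show ?thesis
    using assms by (simp add: powe_powe powe_mult mult.commute)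
qed

lemma powe_ge_of_mult_le:
  assumes "x powe \<alpha> * y powe \<beta> \<le> B" "0 < x" "x < top" "0 < \<beta>" "r \<le> 0"
  shows "B powe (r / \<beta>) * x powe (- (\<alpha> * r / \<beta>)) \<le> y powe r"
proof -
  have "y powe \<beta> = x powe (- \<alpha>) * (x powe \<alpha> * y powe \<beta>)"
    using powe_neg_cancel[OF assms(2,3), of \<alpha>] by (simp add: mult.assoc[symmetric])
  also have "\<dots> \<le> x powe (- \<alpha>) * B"
    using assms(1) by (rule mult_left_mono) simp
  finally have "(B * x powe (- \<alpha>)) powe (r / \<beta>) \<le> (y powe \<beta>) powe (r / \<beta>)"
    using assms by (intro powe_antimono) (auto simp: divide_le_0_iff mult.commute)
  \<comment> \<open>The exponent \<open>r / \<beta>\<close> may be negative, so splitting the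
    product relies on this factor being positive and finite.\<close>
  moreover have "0 < x powe (- \<alpha>)" "x powe (- \<alpha>) < top"
    using assms by (auto simp: powe_eq_top_iff zero_less_iff_neq_zero powe_eq_0_iff simp flip: less_top)
  then have "(B * x powe (- \<alpha>)) powe (r / \<beta>) = B powe (r / \<beta>) * x powe (- (\<alpha> * r / \<beta>))"
    using powe_mult_pos[of "x powe (- \<alpha>)" B "r / \<beta>"] by (simp add: powe_powe mult.commute)
  ultimately show ?thesis
    using assms by (simp add: powe_powe mult.commute)
qed

subsection \<open>Tails of atomless measures\<close>

text \<open>Finite unions of members of a chain are again members, so along an enumeration of the
  index set the partial unions increase and keep the bound c; continuity from below
  finishes.\<close>

lemma emeasure_UN_chain_le:
  fixes A :: "'i \<Rightarrow> 'a set"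
  assumes "countable I"
    and "\<And>i. i \<in> I \<Longrightarrow> A i \<in> sets M"
    and chain: "\<And>i j. i \<in> I \<Longrightarrow> j \<in> I \<Longrightarrow> A i \<subseteq> A j \<or> A j \<subseteq> A i"
    and le: "\<And>i. i \<in> I \<Longrightarrow> emeasure M (A i) \<le> c"
  shows "emeasure M (\<Union>i\<in>I. A i) \<le> c"
proof (cases "I = {}")
  case False
  define e where "e = from_nat_into I"
  have e: "e n \<in> I" for n
    unfolding e_def by (rule from_nat_into[OF False])
  have range: "range e = I"
    unfolding e_def using False \<open>countable I\<close> by (rule range_from_nat_into)
  define U where "U n = (\<Union>k\<le>n. A (e k))" for n
  have U_eq: "\<exists>i\<in>I. U n = A i" for n
  proof (induction n)
    case 0
    then show ?case using e by (auto simp: U_def)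
  next
    case (Suc n)
    then obtain i where "i \<in> I" "U n = A i" by blast
    moreover have "U (Suc n) = U n \<union> A (e (Suc n))"
      by (auto simp: U_def atMost_Suc)
    ultimately show ?case
      using chain[OF \<open>i \<in> I\<close> e[of "Suc n"]] e[of "Suc n"] by (metis Un_absorb1 Un_absorb2)
  qed
  have "(\<Union>i\<in>I. A i) = (\<Union>n. U n)"
    unfolding range[symmetric] by (auto simp: U_def)
  also have "emeasure M \<dots> = (SUP n. emeasure M (U n))"
  proof (rule SUP_emeasure_incseq[symmetric])
    show "range U \<subseteq> sets M"
      using U_eq assms(2) by (metis image_subsetI)
    show "incseq U"
      by (rule monoI) (auto simp: U_def dest: order.trans)
  qed
  also have "\<dots> \<le> c"
    using U_eq le by (metis SUP_least)
  finally show ?thesis .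
qed simp

text \<open>Every point of W except a possible minimum lies in a part of W above some rational that
  is itself above a point of W. These parts form a countable chain of sets of measure at most c, and
  the minimum is a null set.\<close>

lemma emeasure_le_of_upper_parts:
  fixes M :: "real measure"
  assumes borel: "sets borel \<subseteq> sets M" and atomless: "\<And>t. emeasure M {t} = 0"
    and W: "W \<in> sets M" and le: "\<And>w. w \<in> W \<Longrightarrow> emeasure M (W \<inter> {w<..}) \<le> c"
  shows "emeasure M W \<le> c"
proof -
  define I where "I = {r \<in> \<rat>. \<exists>w\<in>W. w \<le> r}"
  define V where "V = (\<Union>r\<in>I. W \<inter> {r<..})"
  have ray: "W \<inter> {r<..} \<in> sets M" for r
    using W borel by (intro sets.Int) auto
  have "countable I"
    unfolding I_def using countable_rat by (rule countable_subset[rotated]) auto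
  have V_sets: "V \<in> sets M"
    unfolding V_def using \<open>countable I\<close> ray by (intro sets.countable_UN') auto
  have V_le: "emeasure M V \<le> c"
    unfolding V_def
  proof (rule emeasure_UN_chain_le[OF \<open>countable I\<close> ray])
    fix r q :: real
    show "W \<inter> {r<..} \<subseteq> W \<inter> {q<..} \<or> W \<inter> {q<..} \<subseteq> W \<inter> {r<..}"
      by (cases "r \<le> q") auto
  next
    fix r assume "r \<in> I"
    then obtain w where w: "w \<in> W" "w \<le> r" by (auto simp: I_def)
    have "emeasure M (W \<inter> {r<..}) \<le> emeasure M (W \<inter> {w<..})"
      using w by (intro emeasure_mono ray) auto
    with le[OF w(1)] show "emeasure M (W \<inter> {r<..}) \<le> c" by simp
  qed
  have *: "t \<in> V" if "w \<in> W" "t \<in> W" "w < t" for w t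
  proof -
    obtain r where "r \<in> \<rat>" "w < r" "r < t"
      using Rats_dense_in_real[OF \<open>w < t\<close>] by blast
    with that show ?thesis by (auto simp: V_def I_def intro!: bexI[of _ r] bexI[of _ w])
  qed
  \<comment> \<open>Of two distinct points of W the larger one belongs to V, so at most one point
    remains.\<close>
  have "\<exists>t. W - V \<subseteq> {t}"
  proof (cases "W - V = {}")
    case False
    then obtain t where "t \<in> W - V" by blast
    moreover have "u = t" if "u \<in> W - V" for u
      using * that \<open>t \<in> W - V\<close> by (metis DiffE linorder_neqE_linordered_idom)
    ultimately show ?thesis by blast
  qed blast
  then obtain t where "W \<subseteq> V \<union> {t}" by blast
  moreover have t_sets: "{t} \<in> sets M" using borel by auto
  ultimately have "emeasure M W \<le> emeasure M (V \<union> {t})"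
    using V_sets t_sets by (intro emeasure_mono sets.Un) auto
  also have "\<dots> \<le> emeasure M V + emeasure M {t}"
    using V_sets t_sets by (intro emeasure_subadditive) auto
  also have "\<dots> \<le> c" using V_le atomless by simp
  finally show ?thesis .
qed

lemma emeasure_le_of_lower_parts:
  fixes M :: "real measure"
  assumes borel: "sets borel \<subseteq> sets M" and atomless: "\<And>t. emeasure M {t} = 0"
    and W: "W \<in> sets M" and le: "\<And>w. w \<in> W \<Longrightarrow> emeasure M (W \<inter> {..<w}) \<le> c"
  shows "emeasure M W \<le> c"
proof -
  have space: "space M = UNIV"
    using borel sets.sets_into_space[of UNIV M] by (auto simp: subset_eq)
  \<comment> \<open>The \<sigma>-algebra of M need not be invariant under negation, so the reflected
    measure is placed on the \<sigma>-algebra of preimages.\<close>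
  define M' where "M' = distr M (vimage_algebra UNIV uminus M) uminus"
  have meas: "uminus \<in> M \<rightarrow>\<^sub>M vimage_algebra UNIV uminus M"
    by (rule measurable_vimage_algebra2) simp_all
  have vimage: "uminus -` A \<in> sets M'" if "A \<in> sets M" for A
    using that by (auto simp: M'_def sets_vimage_algebra2 space)
  have emeasure: "emeasure M' (uminus -` A) = emeasure M A" if "A \<in> sets M" for A
    using emeasure_distr[OF meas, of "uminus -` A"] vimage[OF that]
    by (simp add: M'_def vimage_comp comp_def space)
  have "emeasure M' (uminus -` W) \<le> c"
  proof (rule emeasure_le_of_upper_parts)
    show "sets borel \<subseteq> sets M'"
    proof
      fix B :: "real set" assume "B \<in> sets borel"
      then have "uminus -` B \<in> sets borel"
        using measurable_sets[of uminus borel borel B] by simp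
      then show "B \<in> sets M'"
        using vimage[of "uminus -` B"] borel by (auto simp: vimage_comp comp_def)
    qed
  next
    fix t :: real
    have "{t} = uminus -` {- t}" by auto
    moreover have "{- t} \<in> sets M" using borel by auto
    ultimately show "emeasure M' {t} = 0"
      using emeasure atomless by metis
  next
    fix w assume "w \<in> uminus -` W"
    moreover have "uminus -` W \<inter> {w<..} = uminus -` (W \<inter> {..<- w})" by auto
    moreover have "W \<inter> {..<- w} \<in> sets M"
      using W borel by (intro sets.Int) auto
    ultimately show "emeasure M' (uminus -` W \<inter> {w<..}) \<le> c"
      using le[of "- w"] emeasure by (simp del: vimage_Int)
  qed (rule vimage[OF W])
  then show ?thesis using emeasure[OF W] by simp
qed

lemma borel_measurable_antimono_ennreal:
  fixes f :: "real \<Rightarrow> ennreal"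
  assumes "antimono f"
  shows "f \<in> borel_measurable borel"
proof (rule borel_measurableI_ge)
  fix c
  have "is_interval {t. c \<le> f t}"
    unfolding is_interval_1 using assms by (auto dest: antimonoD order.trans)
  then show "{t \<in> space borel. c \<le> f t} \<in> sets borel"
    by (simp add: real_interval_borel_measurable)
qed

lemma borel_measurable_mono_ennreal:
  fixes f :: "real \<Rightarrow> ennreal"
  assumes "mono f"
  shows "f \<in> borel_measurable borel"
proof (rule borel_measurableI_le)
  fix c
  have "is_interval {t. f t \<le> c}"
    unfolding is_interval_1 using assms by (auto dest: monoD order.trans)
  then show "{t \<in> space borel. f t \<le> c} \<in> sets borel"
    by (simp add: real_interval_borel_measurable)
qed

text \<open>Inclusion of the Borel sets, rather than equality, admits densities of the completed
  Lebesgue measure; f and h are only Lebesgue measurable.\<close>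

locale atomless_measure =
  fixes M :: "real measure"
  assumes borel_sets: "sets borel \<subseteq> sets M" and emeasure_singleton: "emeasure M {t} = 0"
begin

lemma space_eq_UNIV: "space M = UNIV"
  using borel_sets sets.sets_into_space[of UNIV M] by (auto simp: subset_eq)

lemma borel_measurable_borel:
  assumes "h \<in> borel_measurable borel"
  shows "h \<in> borel_measurable M"
  using measurable_sets[OF assms] borel_sets by (auto intro!: measurableI simp: space_eq_UNIV)

lemma emeasure_greaterThan_antimono: "antimono (\<lambda>t. emeasure M {t<..})"
  using borel_sets by (intro antimonoI emeasure_mono) auto

lemma emeasure_lessThan_mono: "mono (\<lambda>t. emeasure M {..<t})"
  using borel_sets by (intro monoI emeasure_mono) auto

lemma measurable_emeasure_greaterThan [measurable]: "(\<lambda>t. emeasure M {t<..}) \<in> borel_measurable M"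
  by (intro borel_measurable_borel borel_measurable_antimono_ennreal emeasure_greaterThan_antimono)

lemma measurable_emeasure_lessThan [measurable]: "(\<lambda>t. emeasure M {..<t}) \<in> borel_measurable M"
  by (intro borel_measurable_borel borel_measurable_mono_ennreal emeasure_lessThan_mono)

text \<open>The part of this set above one of its points w lies in \<open>{w<..}\<close>, whose
  measure is at most c by membership of w.\<close>

lemma emeasure_upper_tail_le: "emeasure M {t. emeasure M {t<..} \<le> c} \<le> c"
proof (rule emeasure_le_of_upper_parts[OF borel_sets emeasure_singleton])
  have "{t \<in> space M. emeasure M {t<..} \<le> c} \<in> sets M" by measurable
  then show "{t. emeasure M {t<..} \<le> c} \<in> sets M" by (simp add: space_eq_UNIV)
  fix w assume "w \<in> {t. emeasure M {t<..} \<le> c}"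
  moreover have "emeasure M ({t. emeasure M {t<..} \<le> c} \<inter> {w<..}) \<le> emeasure M {w<..}"
    using borel_sets by (intro emeasure_mono) auto
  ultimately show "emeasure M ({t. emeasure M {t<..} \<le> c} \<inter> {w<..}) \<le> c" by simp
qed

lemma emeasure_lower_tail_le: "emeasure M {t. emeasure M {..<t} \<le> c} \<le> c"
proof (rule emeasure_le_of_lower_parts[OF borel_sets emeasure_singleton])
  have "{t \<in> space M. emeasure M {..<t} \<le> c} \<in> sets M" by measurable
  then show "{t. emeasure M {..<t} \<le> c} \<in> sets M" by (simp add: space_eq_UNIV)
  fix w assume "w \<in> {t. emeasure M {..<t} \<le> c}"
  moreover have "emeasure M ({t. emeasure M {..<t} \<le> c} \<inter> {..<w}) \<le> emeasure M {..<w}"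
    using borel_sets by (intro emeasure_mono) auto
  ultimately show "emeasure M ({t. emeasure M {..<t} \<le> c} \<inter> {..<w}) \<le> c" by simp
qed

end

subsection \<open>Integrals of powers\<close>

text \<open>Twice a geometric series: the sum of 2^(-k (1 - \<kappa>)) over k \<ge> 1 if \<kappa> <
  1, and of 2^(k (1 - \<kappa>)) over k \<ge> 0 if \<kappa> > 1. The absolute value merges the two
  cases.\<close>

definition tail_const :: "real \<Rightarrow> real" where
  "tail_const \<kappa> = 2 / \<bar>2 powr (1 - \<kappa>) - 1\<bar>"

lemma tail_const_pos: "\<kappa> \<noteq> 1 \<Longrightarrow> tail_const \<kappa> > 0"
  by (simp add: tail_const_def)

text \<open>On the shell where T lies between \<open>c k\<close> and \<open>2 * c k\<close> the
  integrand is at most \<open>c k powr (- \<kappa>)\<close>, and by the tail hypothesis the shell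
  has measure at most \<open>2 * c k\<close>. No shell meets T = \<open>top\<close>; there the
  integrand is 0 if \<kappa> > 0, but 1 if \<kappa> = 0, whence the last hypothesis. T is abstract
  so that upper and lower tails are both covered.\<close>

lemma nn_integral_powe_dyadic_le:
  fixes T :: "'a \<Rightarrow> ennreal" and c :: "nat \<Rightarrow> real"
  assumes [measurable]: "T \<in> borel_measurable M" "A \<in> sets M"
    and tail: "\<And>c. emeasure M {t \<in> space M. T t \<le> c} \<le> c"
    and "0 \<le> \<kappa>" and c_pos: "\<And>k. c k > 0"
    and cover: "AE t in M. t \<in> A \<longrightarrow> T t \<noteq> top \<longrightarrow> (\<exists>k. ennreal (c k) \<le> T t \<and> T t \<le> ennreal (2 * c k))"
    and \<kappa>: "\<kappa> > 0 \<or> (\<forall>t\<in>A. T t \<noteq> top)"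
  shows "(\<integral>\<^sup>+t\<in>A. T t powe (- \<kappa>) \<partial>M) \<le> (\<Sum>k. ennreal (2 * c k powr (1 - \<kappa>)))"
proof -
  define B where "B k = {t \<in> space M. T t \<le> ennreal (2 * c k)}" for k
  have [measurable]: "B k \<in> sets M" for k
    unfolding B_def by measurable
  have "AE t in M. T t powe (- \<kappa>) * indicator A t \<le> (\<Sum>k. ennreal (c k powr (- \<kappa>)) * indicator (B k) t)"
    using cover AE_space
  proof eventually_elim
    case (elim t)
    show ?case
    proof (cases "t \<in> A \<and> T t \<noteq> top")
      case True
      then obtain k where k: "ennreal (c k) \<le> T t" "T t \<le> ennreal (2 * c k)"
        using elim by blast
      have "T t powe (- \<kappa>) * indicator A t \<le> ennreal (c k) powe (- \<kappa>)"
        using True \<open>0 \<le> \<kappa>\<close> k by (auto intro!: powe_antimono)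
      also have "\<dots> = ennreal (c k powr (- \<kappa>)) * indicator (B k) t"
        using k c_pos elim by (simp add: B_def powe_ennreal)
      also have "\<dots> = (\<Sum>k\<in>{k}. ennreal (c k powr (- \<kappa>)) * indicator (B k) t)"
        by (simp only: sum.insert sum.empty finite.emptyI empty_iff if_False not_False_eq_True add_0_right)
      also have "\<dots> \<le> (\<Sum>k. ennreal (c k powr (- \<kappa>)) * indicator (B k) t)"
        by (rule sum_le_suminf) auto
      finally show ?thesis .
    qed (use \<kappa> in \<open>auto simp: top_powe indicator_def\<close>)
  qed
  then have "(\<integral>\<^sup>+t\<in>A. T t powe (- \<kappa>) \<partial>M) \<le> (\<integral>\<^sup>+t. (\<Sum>k. ennreal (c k powr (- \<kappa>)) * indicator (B k) t) \<partial>M)"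
    by (rule nn_integral_mono_AE)
  also have "\<dots> = (\<Sum>k. ennreal (c k powr (- \<kappa>)) * emeasure M (B k))"
    by (simp add: nn_integral_suminf nn_integral_cmult)
  also have "\<dots> \<le> (\<Sum>k. ennreal (2 * c k powr (1 - \<kappa>)))"
  proof (rule suminf_le)
    fix k
    have "ennreal (c k powr (- \<kappa>)) * emeasure M (B k) \<le> ennreal (c k powr (- \<kappa>)) * ennreal (2 * c k)"
      unfolding B_def by (intro mult_left_mono tail) simp
    also have "\<dots> = ennreal (2 * c k powr (1 - \<kappa>))"
      using c_pos[of k] powr_add[of "c k" 1 "- \<kappa>"] by (simp add: mult_ac flip: ennreal_mult)
    finally show "ennreal (c k powr (- \<kappa>)) * emeasure M (B k) \<le> ennreal (2 * c k powr (1 - \<kappa>))" .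
  qed auto
  finally show ?thesis .
qed

lemma ex_dyadic_scale:
  fixes z :: real
  assumes "1 \<le> z"
  shows "\<exists>k. 2 ^ k \<le> z \<and> z < 2 * 2 ^ k"
proof -
  obtain n where n: "z < 2 ^ n"
    using real_arch_pow[of 2 z] by auto
  define k where "k = (LEAST n. z < 2 ^ n)"
  have "z < 2 ^ k" unfolding k_def using n by (rule LeastI)
  moreover from this have "k \<noteq> 0" using assms by (cases "k = 0") auto
  then obtain l where "k = Suc l" by (cases k) auto
  moreover have "\<not> z < 2 ^ l"
    using not_less_Least[of l "\<lambda>n. z < 2 ^ n"] \<open>k = Suc l\<close> by (simp add: k_def)
  ultimately show ?thesis by (auto intro!: exI[of _ l])
qed

lemma suminf_geometric_ennreal:
  assumes "0 \<le> a" "0 \<le> q" "q < 1"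
  shows "(\<Sum>k. ennreal (a * q ^ k)) = ennreal (a / (1 - q))"
proof (rule suminf_ennreal_eq)
  show "(\<lambda>k. a * q ^ k) sums (a / (1 - q))"
    using sums_mult[OF geometric_sums[of q], of a] assms by simp
qed (use assms in auto)

lemma nn_integral_powe_lower_le:
  fixes T :: "'a \<Rightarrow> ennreal"
  assumes [measurable]: "T \<in> borel_measurable M"
    and tail: "\<And>c. emeasure M {t \<in> space M. T t \<le> c} \<le> c"
    and \<kappa>: "0 \<le> \<kappa>" "\<kappa> < 1"
  shows "(\<integral>\<^sup>+t\<in>{t \<in> space M. T t \<le> m}. T t powe (- \<kappa>) \<partial>M) \<le> tail_const \<kappa> * m powe (1 - \<kappa>)"
proof (cases m rule: ennreal_zero_pos_top_cases)
  case zero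
  \<comment> \<open>The tail hypothesis at level 0 makes \<open>T = 0\<close> a null set, so the
    singularity of the negative power is harmless.\<close>
  have "emeasure M {t \<in> space M. T t \<le> 0} = 0"
    using tail[of 0] by simp
  then have "AE t in M. \<not> T t \<le> 0"
    by (intro AE_I'[of "{t \<in> space M. T t \<le> 0}"]) (auto simp: null_sets_def)
  then have "(\<integral>\<^sup>+t\<in>{t \<in> space M. T t \<le> m}. T t powe (- \<kappa>) \<partial>M) = (\<integral>\<^sup>+t. 0 \<partial>M)"
    unfolding zero by (intro nn_integral_cong_AE) auto
  then show ?thesis by simp
next
  case (pos r)
  define q where "q = 2 powr (- (1 - \<kappa>))"
  have q: "0 < q" "q < 1" using \<kappa> by (auto simp: q_def powr_less_one)
  have "emeasure M {t \<in> space M. T t \<le> 0} = 0"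
    using tail[of 0] by simp
  then have "AE t in M. \<not> T t \<le> 0"
    by (intro AE_I'[of "{t \<in> space M. T t \<le> 0}"]) (auto simp: null_sets_def)
  \<comment> \<open>The shells descend from r. The lower ends start at r / 2, so that the first
    shell ends exactly at r; this is the source of the extra factor q below.\<close>
  then have cover: "AE t in M. t \<in> {t \<in> space M. T t \<le> m} \<longrightarrow> T t \<noteq> top \<longrightarrow>
      (\<exists>k. ennreal (r / 2 / 2 ^ k) \<le> T t \<and> T t \<le> ennreal (2 * (r / 2 / 2 ^ k)))"
  proof eventually_elim
    case (elim t)
    show ?case
    proof (intro impI)
      assume "t \<in> {t \<in> space M. T t \<le> m}" "T t \<noteq> top"
      with elim obtain u where u: "u > 0" "T t = ennreal u" "u \<le> r"
        using pos by (cases "T t" rule: ennreal_zero_pos_top_cases) auto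
      then obtain k where "2 ^ k \<le> r / u" "r / u < 2 * 2 ^ k"
        using ex_dyadic_scale[of "r / u"] by auto
      with u show "\<exists>k. ennreal (r / 2 / 2 ^ k) \<le> T t \<and> T t \<le> ennreal (2 * (r / 2 / 2 ^ k))"
        by (intro exI[of _ k]) (auto simp: field_simps intro!: ennreal_leI)
    qed
  qed
  have "(\<integral>\<^sup>+t\<in>{t \<in> space M. T t \<le> m}. T t powe (- \<kappa>) \<partial>M)
      \<le> (\<Sum>k. ennreal (2 * (r / 2 / 2 ^ k) powr (1 - \<kappa>)))"
    using pos \<kappa> by (intro nn_integral_powe_dyadic_le tail cover) (auto simp: top_unique)
  also have "\<dots> = (\<Sum>k. ennreal (2 * (r powr (1 - \<kappa>) * q) * q ^ k))"
  proof (intro suminf_cong)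
    fix k
    have "r / 2 / 2 ^ k = r * 2 powr (- (1 + real k))"
      by (simp add: powr_minus powr_diff powr_realpow divide_simps)
    then have "(r / 2 / 2 ^ k) powr (1 - \<kappa>) = r powr (1 - \<kappa>) * 2 powr (- (1 + real k) * (1 - \<kappa>))"
      using pos by (simp only: powr_mult powr_powr)
    also have "2 powr (- (1 + real k) * (1 - \<kappa>)) = (2 powr (- (1 - \<kappa>))) powr (1 + real k)"
      unfolding powr_powr by (rule arg_cong[where f = "\<lambda>z. 2 powr z"]) (simp add: algebra_simps)
    also have "\<dots> = q * q ^ k"
      using q unfolding q_def[symmetric] by (simp add: powr_add powr_realpow)
    finally show "ennreal (2 * (r / 2 / 2 ^ k) powr (1 - \<kappa>)) = ennreal (2 * (r powr (1 - \<kappa>) * q) * q ^ k)"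
      by (simp add: mult_ac)
  qed
  also have "\<dots> = ennreal (2 * (r powr (1 - \<kappa>) * q) / (1 - q))"
    using q by (intro suminf_geometric_ennreal) auto
  also have "\<dots> = ennreal (tail_const \<kappa> * r powr (1 - \<kappa>))"
  proof -
    have "2 powr (1 - \<kappa>) > 1" using \<kappa> by simp
    moreover have "q = 1 / 2 powr (1 - \<kappa>)" unfolding q_def by (rule powr_minus_divide)
    ultimately have "q / (1 - q) = 1 / (2 powr (1 - \<kappa>) - 1)"
      using q by (subst frac_eq_eq) (auto simp: divide_simps, simp add: right_diff_distrib)
    then have "2 * (r powr (1 - \<kappa>) * q) / (1 - q) = 2 * r powr (1 - \<kappa>) * (1 / (2 powr (1 - \<kappa>) - 1))"
      by (metis mult.assoc times_divide_eq_right)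
    then show ?thesis using \<open>2 powr (1 - \<kappa>) > 1\<close> by (simp add: tail_const_def)
  qed
  also have "\<dots> = tail_const \<kappa> * m powe (1 - \<kappa>)"
    using pos tail_const_pos[of \<kappa>] \<kappa> by (simp add: powe_ennreal ennreal_mult')
  finally show ?thesis .
next
  case top
  have "tail_const \<kappa> > 0" using \<kappa> by (intro tail_const_pos) simp
  then show ?thesis using top \<kappa> by (simp add: top_powe ennreal_mult_top)
qed

lemma nn_integral_powe_upper_le:
  fixes T :: "'a \<Rightarrow> ennreal"
  assumes [measurable]: "T \<in> borel_measurable M"
    and tail: "\<And>c. emeasure M {t \<in> space M. T t \<le> c} \<le> c"
    and \<kappa>: "1 < \<kappa>"
  shows "(\<integral>\<^sup>+t\<in>{t \<in> space M. m \<le> T t}. T t powe (- \<kappa>) \<partial>M) \<le> tail_const \<kappa> * m powe (1 - \<kappa>)"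
proof (cases m rule: ennreal_zero_pos_top_cases)
  case zero
  have "tail_const \<kappa> > 0" using \<kappa> by (intro tail_const_pos) simp
  then show ?thesis using zero \<kappa> by (simp add: zero_powe ennreal_mult_top)
next
  case (pos r)
  define q where "q = 2 powr (1 - \<kappa>)"
  have q: "0 < q" "q < 1" using \<kappa> by (auto simp: q_def powr_less_one)
  \<comment> \<open>Here the shells ascend from r, and the sum converges because 1 - \<kappa> is
    negative.\<close>
  have cover: "\<exists>k. ennreal (r * 2 ^ k) \<le> T t \<and> T t \<le> ennreal (2 * (r * 2 ^ k))"
    if t: "m \<le> T t" "T t \<noteq> top" for t
  proof -
    obtain u where u: "T t = ennreal u" "r \<le> u"
      using t pos by (cases "T t" rule: ennreal_zero_pos_top_cases) (auto simp: ennreal_eq_0_iff)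
    then obtain k where "2 ^ k \<le> u / r" "u / r < 2 * 2 ^ k"
      using ex_dyadic_scale[of "u / r"] pos by auto
    with u pos show ?thesis
      by (intro exI[of _ k]) (auto simp: field_simps intro!: ennreal_leI)
  qed
  have "(\<integral>\<^sup>+t\<in>{t \<in> space M. m \<le> T t}. T t powe (- \<kappa>) \<partial>M)
      \<le> (\<Sum>k. ennreal (2 * (r * 2 ^ k) powr (1 - \<kappa>)))"
    using pos \<kappa> by (intro nn_integral_powe_dyadic_le tail) (auto intro!: AE_I2 cover)
  also have "\<dots> = (\<Sum>k. ennreal (2 * r powr (1 - \<kappa>) * q ^ k))"
    using pos by (intro suminf_cong)
      (simp add: q_def powr_mult powr_powr powr_power mult_ac flip: powr_realpow)
  also have "\<dots> = ennreal (2 * r powr (1 - \<kappa>) / (1 - q))"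
    using q by (intro suminf_geometric_ennreal) auto
  also have "\<dots> = ennreal (tail_const \<kappa> * r powr (1 - \<kappa>))"
    using q by (simp add: tail_const_def q_def)
  also have "\<dots> = tail_const \<kappa> * m powe (1 - \<kappa>)"
    using pos tail_const_pos[of \<kappa>] \<kappa> by (simp add: powe_ennreal ennreal_mult')
  finally show ?thesis .
next
  case top
  have "(\<integral>\<^sup>+t\<in>{t \<in> space M. m \<le> T t}. T t powe (- \<kappa>) \<partial>M) = (\<integral>\<^sup>+t. 0 \<partial>M)"
    using top \<kappa> by (intro nn_integral_cong) (auto simp: top_unique top_powe split: split_indicator)
  then show ?thesis by simp
qed

text \<open>A cut at the level of T where the two entries of the minimum agree: below it A is
  integrated, above it the power. Both parts have the same size up to a constant, and no reference
  to a point y is left.\<close>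

lemma nn_integral_min_powe_le:
  fixes T :: "'a \<Rightarrow> ennreal"
  assumes [measurable]: "T \<in> borel_measurable M"
    and tail: "\<And>c. emeasure M {t \<in> space M. T t \<le> c} \<le> c"
    and \<kappa>: "1 < \<kappa>" and A: "A < top" and B: "B < top"
  shows "(\<integral>\<^sup>+t. min A (B * T t powe (- \<kappa>)) \<partial>M)
    \<le> ennreal (1 + tail_const \<kappa>) * (A powe (1 - 1 / \<kappa>) * B powe (1 / \<kappa>))"
proof (cases "A = 0 \<or> B = 0")
  case True
  then show ?thesis by auto
next
  case False
  then have pos: "0 < A" "0 < B" by (auto simp: zero_less_iff_neq_zero)
  \<comment> \<open>The solution of A = B m^(-\<kappa>).\<close>
  define m where "m = B powe (1 / \<kappa>) * A powe (- (1 / \<kappa>))"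
  have tc: "tail_const \<kappa> > 0" using \<kappa> by (intro tail_const_pos) simp
  have Apos: "0 < A powe r" "A powe r < top" and Bpos: "0 < B powe r" "B powe r < top" for r
    using pos A B by (auto simp: powe_eq_top_iff powe_eq_0_iff zero_less_iff_neq_zero simp flip: less_top)
  have Am: "A * m = A powe (1 - 1 / \<kappa>) * B powe (1 / \<kappa>)"
    using powe_add[OF pos(1) A, of 1 "- (1 / \<kappa>)"] by (simp add: m_def mult_ac)
  have "m powe (1 - \<kappa>) = B powe ((1 / \<kappa>) * (1 - \<kappa>)) * A powe (- (1 / \<kappa>) * (1 - \<kappa>))"
    unfolding m_def using powe_mult_pos[OF Bpos] by (simp add: powe_powe)
  also have "(1 / \<kappa>) * (1 - \<kappa>) = 1 / \<kappa> - 1"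
    using \<kappa> by (simp add: field_simps)
  also have "- (1 / \<kappa>) * (1 - \<kappa>) = 1 - 1 / \<kappa>"
    using \<kappa> by (simp add: field_simps)
  finally have Bm: "B * m powe (1 - \<kappa>) = A powe (1 - 1 / \<kappa>) * B powe (1 / \<kappa>)"
    using powe_add[OF pos(2) B, of 1 "1 / \<kappa> - 1"] by (simp add: mult_ac)
  have "(\<integral>\<^sup>+t. min A (B * T t powe (- \<kappa>)) \<partial>M)
    \<le> (\<integral>\<^sup>+t. A * indicator {t \<in> space M. T t \<le> m} t
        + B * (T t powe (- \<kappa>) * indicator {t \<in> space M. m \<le> T t} t) \<partial>M)"
    by (intro nn_integral_mono) (auto simp: indicator_def min_le_iff_disj intro: order.trans[OF _ add_increasing2])
  also have "\<dots> = A * emeasure M {t \<in> space M. T t \<le> m}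
      + B * (\<integral>\<^sup>+t\<in>{t \<in> space M. m \<le> T t}. T t powe (- \<kappa>) \<partial>M)"
    by (simp add: nn_integral_add nn_integral_cmult)
  also have "\<dots> \<le> A * m + B * (tail_const \<kappa> * m powe (1 - \<kappa>))"
    by (intro add_mono mult_left_mono tail nn_integral_powe_upper_le \<kappa>) auto
  also have "\<dots> = A * m + tail_const \<kappa> * (B * m powe (1 - \<kappa>))"
    by (simp only: mult_ac)
  also have "\<dots> = ennreal (1 + tail_const \<kappa>) * (A powe (1 - 1 / \<kappa>) * B powe (1 / \<kappa>))"
    unfolding Am Bm using tc by (simp add: distrib_right)
  finally show ?thesis .
qed

subsection \<open>Bounds for a weighted tail\<close>

context atomless_measure
begin

text \<open>This makes the tail estimates available for measures weighted by a power of h or of h +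
  G.\<close>

lemma atomless_density:
  assumes [measurable]: "w \<in> borel_measurable M"
  shows "atomless_measure (density M w)"
proof
  fix t
  have "{t} \<in> null_sets M"
    using borel_sets emeasure_singleton by (auto simp: null_sets_def)
  then show "emeasure (density M w) {t} = 0"
    using absolutely_continuousI_density[OF assms] by (auto simp: absolutely_continuous_def null_sets_def)
qed (use borel_sets in simp)

lemma rays [measurable]: "{y<..} \<in> sets M" "{..<y} \<in> sets M"
  using borel_sets by auto

lemma AE_emeasure_greaterThan_pos: "AE t in M. 0 < emeasure M {t<..}"
proof (rule AE_I')
  have "{t \<in> space M. emeasure M {t<..} \<le> 0} \<in> sets M" by measurable
  then show "{t. emeasure M {t<..} \<le> 0} \<in> null_sets M"
    using emeasure_upper_tail_le[of 0] by (simp add: null_sets_def space_eq_UNIV)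
qed (auto simp: zero_less_iff_neq_zero)

lemma AE_emeasure_lessThan_pos: "AE t in M. 0 < emeasure M {..<t}"
proof (rule AE_I')
  have "{t \<in> space M. emeasure M {..<t} \<le> 0} \<in> sets M" by measurable
  then show "{t. emeasure M {..<t} \<le> 0} \<in> null_sets M"
    using emeasure_lower_tail_le[of 0] by (simp add: null_sets_def space_eq_UNIV)
qed (auto simp: zero_less_iff_neq_zero)

text \<open>To the right of y the tail is at most its value at y, so the ray lies in a sublevel set,
  where the dyadic estimate applies.\<close>

lemma nn_integral_upper_tail_powe_le:
  assumes "0 \<le> \<kappa>" "\<kappa> < 1"
  shows "(\<integral>\<^sup>+t\<in>{y<..}. emeasure M {t<..} powe (- \<kappa>) \<partial>M)
    \<le> tail_const \<kappa> * emeasure M {y<..} powe (1 - \<kappa>)"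
proof -
  have "(\<integral>\<^sup>+t\<in>{y<..}. emeasure M {t<..} powe (- \<kappa>) \<partial>M)
    \<le> (\<integral>\<^sup>+t\<in>{t \<in> space M. emeasure M {t<..} \<le> emeasure M {y<..}}. emeasure M {t<..} powe (- \<kappa>) \<partial>M)"
    by (intro nn_integral_mono)
      (auto simp: space_eq_UNIV indicator_def intro: antimonoD[OF emeasure_greaterThan_antimono])
  also have "\<dots> \<le> tail_const \<kappa> * emeasure M {y<..} powe (1 - \<kappa>)"
    using assms emeasure_upper_tail_le by (intro nn_integral_powe_lower_le) (auto simp: space_eq_UNIV)
  finally show ?thesis .
qed

lemma nn_integral_upper_tail_powe_le':
  assumes "1 < \<kappa>"
  shows "(\<integral>\<^sup>+t\<in>{..<y}. emeasure M {t<..} powe (- \<kappa>) \<partial>M)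
    \<le> tail_const \<kappa> * emeasure M {y<..} powe (1 - \<kappa>)"
proof -
  have "(\<integral>\<^sup>+t\<in>{..<y}. emeasure M {t<..} powe (- \<kappa>) \<partial>M)
    \<le> (\<integral>\<^sup>+t\<in>{t \<in> space M. emeasure M {y<..} \<le> emeasure M {t<..}}. emeasure M {t<..} powe (- \<kappa>) \<partial>M)"
    by (intro nn_integral_mono)
      (auto simp: space_eq_UNIV indicator_def intro: antimonoD[OF emeasure_greaterThan_antimono])
  also have "\<dots> \<le> tail_const \<kappa> * emeasure M {y<..} powe (1 - \<kappa>)"
    using assms emeasure_upper_tail_le by (intro nn_integral_powe_upper_le) (auto simp: space_eq_UNIV)
  finally show ?thesis .
qed

lemma nn_integral_min_upper_tail_le:
  assumes "1 < \<kappa>" "A < top" "B < top"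
  shows "(\<integral>\<^sup>+t. min A (B * emeasure M {t<..} powe (- \<kappa>)) \<partial>M)
    \<le> ennreal (1 + tail_const \<kappa>) * (A powe (1 - 1 / \<kappa>) * B powe (1 / \<kappa>))"
  using assms emeasure_upper_tail_le by (intro nn_integral_min_powe_le) (auto simp: space_eq_UNIV)

lemma nn_integral_min_lower_tail_le:
  assumes "1 < \<kappa>" "A < top" "B < top"
  shows "(\<integral>\<^sup>+t. min A (B * emeasure M {..<t} powe (- \<kappa>)) \<partial>M)
    \<le> ennreal (1 + tail_const \<kappa>) * (A powe (1 - 1 / \<kappa>) * B powe (1 / \<kappa>))"
  using assms emeasure_lower_tail_le by (intro nn_integral_min_powe_le) (auto simp: space_eq_UNIV)

end

text \<open>Of G only monotonicity, measurability and finiteness are kept, not its origin as an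
  integral. Since almost every point lies in I, the rays \<open>{y<..}\<close> and
  \<open>{..<y}\<close> can stand for the two pieces of I on either side of y.\<close>

locale weighted_tail = atomless_measure +
  fixes I :: "real set" and G :: "real \<Rightarrow> ennreal"
  assumes AE_I: "AE t in M. t \<in> I"
    and tail_finite: "y \<in> I \<Longrightarrow> emeasure M {y<..} < top"
    and G_measurable [measurable]: "G \<in> borel_measurable M"
    and G_mono: "y \<in> I \<Longrightarrow> t \<in> I \<Longrightarrow> y \<le> t \<Longrightarrow> G y \<le> G t"
    and G_finite: "y \<in> I \<Longrightarrow> G y < top"
begin

definition F :: "real \<Rightarrow> ennreal" where
  "F y = emeasure M {y<..}"

lemma F_measurable [measurable]: "F \<in> borel_measurable M"
  unfolding F_def by measurable

lemma F_finite: "y \<in> I \<Longrightarrow> F y < top"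
  unfolding F_def by (rule tail_finite)

lemma AE_I_F_pos: "AE t in M. t \<in> I \<and> 0 < F t"
  using AE_I AE_emeasure_greaterThan_pos by (simp add: F_def)

lemma const_mult_F_le:
  assumes "\<And>t. t \<in> I \<Longrightarrow> y < t \<Longrightarrow> c \<le> H t"
  shows "c * F y \<le> (\<integral>\<^sup>+t\<in>{y<..}. H t \<partial>M)"
proof -
  have "c * F y = (\<integral>\<^sup>+t\<in>{y<..}. c \<partial>M)"
    by (simp add: F_def nn_integral_cmult_indicator)
  also have "\<dots> \<le> (\<integral>\<^sup>+t\<in>{y<..}. H t \<partial>M)"
    using AE_I assms by (intro nn_integral_mono_AE) (auto split: split_indicator)
  finally show ?thesis .
qed

lemma le_const_mult_F:
  assumes "\<And>t. t \<in> I \<Longrightarrow> y < t \<Longrightarrow> H t \<le> c"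
  shows "(\<integral>\<^sup>+t\<in>{y<..}. H t \<partial>M) \<le> c * F y"
proof -
  have "(\<integral>\<^sup>+t\<in>{y<..}. H t \<partial>M) \<le> (\<integral>\<^sup>+t\<in>{y<..}. c \<partial>M)"
    using AE_I assms by (intro nn_integral_mono_AE) (auto split: split_indicator)
  also have "\<dots> = c * F y"
    by (simp add: F_def nn_integral_cmult_indicator)
  finally show ?thesis .
qed

lemma G_powe_le:
  fixes S :: ennreal
  assumes "\<And>y. y \<in> I \<Longrightarrow> F y powe \<alpha> * G y powe \<beta> \<le> S" "0 < \<beta>" "0 \<le> r"
  shows "AE t in M. G t powe r \<le> S powe (r / \<beta>) * F t powe (- (\<alpha> * r / \<beta>))"
  using AE_I_F_pos
proof eventually_elim
  case (elim t)
  then show ?case using assms F_finite by (intro powe_le_of_mult_le) auto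
qed

text \<open>The set where F is at most half of \<open>F y\<close> has measure at most that half, so
  the rest of the ray carries at least the other half. This replaces picking a point where F has
  dropped to half by continuity.\<close>

lemma upper_half_mass:
  assumes "y \<in> I"
  shows "F y / 2 \<le> emeasure M {t. y < t \<and> F y / 2 < F t}"
proof -
  define c where "c = F y / 2"
  have c: "c + c = F y" unfolding c_def
    by (metis ennreal_divide_times mult.commute mult_2 ennreal_times_divide divide_eq_1_ennreal ennreal_divide_self mult.right_neutral zero_neq_numeral ennreal_numeral_less_top)
  have "c < top" using c F_finite[OF assms] by (cases "c = top") (auto simp: less_top)
  have V: "{t. y < t \<and> c < F t} \<in> sets M"
  proof -
    have "{t \<in> space M. y < t \<and> c < F t} = {y<..} \<inter> {t \<in> space M. c < F t}" 
      by (auto simp: space_eq_UNIV)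
    also have "\<dots> \<in> sets M" by measurable
    finally show ?thesis by (simp add: space_eq_UNIV)
  qed
  have W: "{t \<in> space M. F t \<le> c} \<in> sets M" by measurable
  have "F y \<le> emeasure M ({t \<in> space M. F t \<le> c} \<union> {t. y < t \<and> c < F t})"
    unfolding F_def[of y] using V W by (intro emeasure_mono) (auto simp: space_eq_UNIV)
  also have "\<dots> \<le> emeasure M {t \<in> space M. F t \<le> c} + emeasure M {t. y < t \<and> c < F t}"
    by (rule emeasure_subadditive[OF W V])
  also have "\<dots> \<le> c + emeasure M {t. y < t \<and> c < F t}"
    using emeasure_upper_tail_le[of c] by (intro add_right_mono) (simp add: space_eq_UNIV F_def)
  finally have "c + c \<le> c + emeasure M {t. y < t \<and> c < F t}" using c by simp
  moreover have "c \<noteq> top" using \<open>c < top\<close> by simp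
  ultimately show ?thesis
    by (simp add: c_def[symmetric])
qed

section \<open>Upper bounds for the right-hand sides of (i)--(v) in terms of S\<close>

lemma sup_bound_i_ge:
  fixes S :: ennreal
  assumes S: "\<And>y. y \<in> I \<Longrightarrow> F y powe \<alpha> * G y powe \<beta> \<le> S"
    and "0 < \<alpha>" "0 < \<beta>" "0 < s" "s \<le> \<beta>" "y \<in> I"
  shows "(\<integral>\<^sup>+t\<in>{y<..}. G t powe ((\<beta> - s) / \<alpha>) \<partial>M) powe \<alpha> * G y powe s
    \<le> tail_const ((\<beta> - s) / \<beta>) powr \<alpha> * S"
proof -
  define \<kappa> where "\<kappa> = (\<beta> - s) / \<beta>"
  have \<kappa>: "0 \<le> \<kappa>" "\<kappa> < 1" and tc: "tail_const \<kappa> > 0"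
    using assms by (auto simp: \<kappa>_def field_simps intro!: tail_const_pos)
  have exps: "(\<beta> - s) / \<alpha> / \<beta> = \<kappa> / \<alpha>" "\<alpha> * ((\<beta> - s) / \<alpha>) / \<beta> = \<kappa>" "1 - \<kappa> = s / \<beta>"
    using assms by (auto simp: \<kappa>_def field_simps)
  have "(\<integral>\<^sup>+t\<in>{y<..}. G t powe ((\<beta> - s) / \<alpha>) \<partial>M)
    \<le> (\<integral>\<^sup>+t. S powe (\<kappa> / \<alpha>) * (F t powe (- \<kappa>) * indicator {y<..} t) \<partial>M)"
    using G_powe_le[of \<alpha> \<beta> S "(\<beta> - s) / \<alpha>"] assms exps
    by (intro nn_integral_mono_AE) (auto split: split_indicator)
  also have "\<dots> = S powe (\<kappa> / \<alpha>) * (\<integral>\<^sup>+t\<in>{y<..}. F t powe (- \<kappa>) \<partial>M)"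
    by (simp add: nn_integral_cmult)
  also have "\<dots> \<le> S powe (\<kappa> / \<alpha>) * (tail_const \<kappa> * F y powe (1 - \<kappa>))"
    unfolding F_def by (intro mult_left_mono nn_integral_upper_tail_powe_le \<kappa>) simp
  finally have "(\<integral>\<^sup>+t\<in>{y<..}. G t powe ((\<beta> - s) / \<alpha>) \<partial>M) powe \<alpha> * G y powe s
    \<le> (S powe (\<kappa> / \<alpha>) * (tail_const \<kappa> * F y powe (s / \<beta>))) powe \<alpha> * G y powe s"
    using assms exps by (intro mult_right_mono powe_mono) auto
  \<comment> \<open>Since 1 - \<kappa> = s / \<beta>, the powers of F(y) and G(y) combine to a power
    of the quantity bounded by S, and the two exponents of S add up to 1.\<close>
  also have "\<dots> = tail_const \<kappa> powr \<alpha> * (S powe \<kappa> * (F y powe \<alpha> * G y powe \<beta>) powe (s / \<beta>))"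
    using assms tc by (simp add: powe_mult powe_powe powe_ennreal mult_ac)
  also have "\<dots> \<le> tail_const \<kappa> powr \<alpha> * (S powe \<kappa> * S powe (s / \<beta>))"
    using assms by (intro mult_left_mono powe_mono S) auto
  also have "S powe \<kappa> * S powe (s / \<beta>) = S"
    using assms \<kappa> exps by (intro powe_split_1) auto
  finally show ?thesis by (simp add: \<kappa>_def)
qed

text \<open>For \<beta> < s the weight decreases in t, so it is bounded by its value at y; the
  estimate holds at each y separately with constant 1.\<close>

lemma sup_bound_i_less:
  assumes "0 < \<alpha>" "0 < s" "\<beta> < s" "y \<in> I"
  shows "(\<integral>\<^sup>+t\<in>{y<..}. G t powe ((\<beta> - s) / \<alpha>) \<partial>M) powe \<alpha> * G y powe s
    \<le> F y powe \<alpha> * G y powe \<beta>"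
proof -
  have "(\<integral>\<^sup>+t\<in>{y<..}. G t powe ((\<beta> - s) / \<alpha>) \<partial>M) \<le> G y powe ((\<beta> - s) / \<alpha>) * F y"
    using assms by (intro le_const_mult_F powe_antimono G_mono) (auto simp: divide_le_0_iff)
  then have "(\<integral>\<^sup>+t\<in>{y<..}. G t powe ((\<beta> - s) / \<alpha>) \<partial>M) powe \<alpha> * G y powe s
    \<le> (G y powe ((\<beta> - s) / \<alpha>) * F y) powe \<alpha> * G y powe s"
    using assms by (intro mult_right_mono powe_mono) auto
  also have "\<dots> = F y powe \<alpha> * (G y powe (\<beta> - s) * G y powe s)"
    using assms by (simp add: powe_mult powe_powe mult_ac)
  also have "\<dots> \<le> F y powe \<alpha> * G y powe \<beta>"
    using powe_add_le[of "G y" "\<beta> - s" s] by (intro mult_left_mono) auto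
  finally show ?thesis .
qed

text \<open>To the left of y the weight is bounded both by \<open>G y powe q\<close> and by a power
  of S times \<open>F t powe (- \<kappa>)\<close>. Integrating the minimum produces exactly
  \<open>G y powe s\<close> after the outer power, which cancels, and S to the power 1. The case S =
  \<open>top\<close> is separate because the estimate for the minimum needs finite entries.\<close>

lemma sup_bound_ii:
  fixes S :: ennreal
  assumes S: "\<And>y. y \<in> I \<Longrightarrow> F y powe \<alpha> * G y powe \<beta> \<le> S"
    and "0 < \<alpha>" "0 < \<beta>" "0 < s" "y \<in> I"
  shows "(\<integral>\<^sup>+t\<in>{..<y}. G t powe ((\<beta> + s) / \<alpha>) \<partial>M) powe \<alpha> * G y powe (- s)
    \<le> (1 + tail_const ((\<beta> + s) / \<beta>)) powr \<alpha> * S"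
proof (cases "S = top")
  case True
  have "tail_const ((\<beta> + s) / \<beta>) > 0"
    using assms by (intro tail_const_pos) (auto simp: field_simps)
  then show ?thesis using True by (simp add: ennreal_mult_top)
next
  case False
  define \<kappa> q where "\<kappa> = (\<beta> + s) / \<beta>" and "q = (\<beta> + s) / \<alpha>"
  have \<kappa>: "1 < \<kappa>" and tc: "tail_const \<kappa> > 0"
    using assms by (auto simp: \<kappa>_def field_simps intro!: tail_const_pos)
  have q: "0 < q" using assms by (simp add: q_def)
  have exps: "\<alpha> * q / \<beta> = \<kappa>" "q * (1 - 1 / \<kappa>) * \<alpha> = s" "q / \<beta> * (1 / \<kappa>) * \<alpha> = 1"
    using assms \<kappa> by (simp_all add: \<kappa>_def q_def divide_simps)
  have "(\<integral>\<^sup>+t\<in>{..<y}. G t powe q \<partial>M)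
    \<le> (\<integral>\<^sup>+t. min (G y powe q) (S powe (q / \<beta>) * F t powe (- \<kappa>)) \<partial>M)"
  proof (rule nn_integral_mono_AE)
    have "AE t in M. G t powe q \<le> S powe (q / \<beta>) * F t powe (- \<kappa>)"
      using G_powe_le[OF S, of q] assms q exps by simp
    with AE_I show "AE t in M. G t powe q * indicator {..<y} t
        \<le> min (G y powe q) (S powe (q / \<beta>) * F t powe (- \<kappa>))"
    proof eventually_elim
      case (elim t)
      then show ?case
        using assms q by (auto split: split_indicator intro!: powe_mono G_mono)
    qed
  qed
  also have "\<dots> \<le> ennreal (1 + tail_const \<kappa>) * ((G y powe q) powe (1 - 1 / \<kappa>) * (S powe (q / \<beta>)) powe (1 / \<kappa>))"
    unfolding F_def using assms False q G_finite[OF \<open>y \<in> I\<close>] \<kappa>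
    by (intro nn_integral_min_upper_tail_le)
       (auto simp: powe_eq_top_iff divide_less_0_iff simp flip: less_top)
  finally have "(\<integral>\<^sup>+t\<in>{..<y}. G t powe q \<partial>M) powe \<alpha> * G y powe (- s) \<le>
      (ennreal (1 + tail_const \<kappa>) * ((G y powe q) powe (1 - 1 / \<kappa>) * (S powe (q / \<beta>)) powe (1 / \<kappa>))) powe \<alpha>
        * G y powe (- s)"
    using assms by (intro mult_right_mono powe_mono) auto
  also have "\<dots> = (1 + tail_const \<kappa>) powr \<alpha> * S * (G y powe s * G y powe (- s))"
    using assms tc q exps by (simp add: powe_mult powe_powe powe_ennreal mult_ac del: ennreal_plus)
  also have "\<dots> \<le> (1 + tail_const \<kappa>) powr \<alpha> * S * 1"
    by (intro mult_left_mono powe_cancel_le) auto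
  finally show ?thesis by (simp add: \<kappa>_def q_def)
qed

lemma sup_bound_iii:
  fixes S :: ennreal
  assumes S: "\<And>y. y \<in> I \<Longrightarrow> F y powe \<alpha> * G y powe \<beta> \<le> S"
    and "0 < \<alpha>" "0 < \<beta>" "0 < s" "y \<in> I"
  shows "(\<integral>\<^sup>+t\<in>{y<..}. G t powe (\<beta> / (\<alpha> + s)) \<partial>M) powe (\<alpha> + s) * F y powe (- s)
    \<le> tail_const (\<alpha> / (\<alpha> + s)) powr (\<alpha> + s) * S"
proof -
  define \<kappa> where "\<kappa> = \<alpha> / (\<alpha> + s)"
  have \<kappa>: "0 \<le> \<kappa>" "\<kappa> < 1" and tc: "tail_const \<kappa> > 0"
    using assms by (auto simp: \<kappa>_def field_simps intro!: tail_const_pos)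
  have exps: "\<beta> / (\<alpha> + s) / \<beta> = 1 / (\<alpha> + s)" "\<alpha> * (\<beta> / (\<alpha> + s)) / \<beta> = \<kappa>" "(1 - \<kappa>) * (\<alpha> + s) = s"
    using assms by (simp_all add: \<kappa>_def divide_simps)
  have "(\<integral>\<^sup>+t\<in>{y<..}. G t powe (\<beta> / (\<alpha> + s)) \<partial>M)
    \<le> (\<integral>\<^sup>+t. S powe (1 / (\<alpha> + s)) * (F t powe (- \<kappa>) * indicator {y<..} t) \<partial>M)"
    using G_powe_le[of \<alpha> \<beta> S "\<beta> / (\<alpha> + s)"] assms exps
    by (intro nn_integral_mono_AE) (auto split: split_indicator)
  also have "\<dots> = S powe (1 / (\<alpha> + s)) * (\<integral>\<^sup>+t\<in>{y<..}. F t powe (- \<kappa>) \<partial>M)"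
    by (simp add: nn_integral_cmult)
  also have "\<dots> \<le> S powe (1 / (\<alpha> + s)) * (tail_const \<kappa> * F y powe (1 - \<kappa>))"
    unfolding F_def by (intro mult_left_mono nn_integral_upper_tail_powe_le \<kappa>) simp
  finally have "(\<integral>\<^sup>+t\<in>{y<..}. G t powe (\<beta> / (\<alpha> + s)) \<partial>M) powe (\<alpha> + s) * F y powe (- s)
    \<le> (S powe (1 / (\<alpha> + s)) * (tail_const \<kappa> * F y powe (1 - \<kappa>))) powe (\<alpha> + s) * F y powe (- s)"
    using assms by (intro mult_right_mono powe_mono) auto
  also have "\<dots> = tail_const \<kappa> powr (\<alpha> + s) * S * (F y powe s * F y powe (- s))"
    using assms tc exps by (simp add: powe_mult powe_powe powe_ennreal mult_ac)
  \<comment> \<open>Only an inequality: at F(y) = 0 the product of the two powers is 0, not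
    1.\<close>
  also have "\<dots> \<le> tail_const \<kappa> powr (\<alpha> + s) * S * 1"
    by (intro mult_left_mono powe_cancel_le) auto
  finally show ?thesis by (simp add: \<kappa>_def)
qed

lemma sup_bound_iv:
  fixes S :: ennreal
  assumes S: "\<And>y. y \<in> I \<Longrightarrow> F y powe \<alpha> * G y powe \<beta> \<le> S"
    and "0 < \<alpha>" "0 < \<beta>" "0 < s" "s < \<alpha>" "y \<in> I"
  shows "(\<integral>\<^sup>+t\<in>{..<y}. G t powe (\<beta> / (\<alpha> - s)) \<partial>M) powe (\<alpha> - s) * F y powe s
    \<le> tail_const (\<alpha> / (\<alpha> - s)) powr (\<alpha> - s) * S"
proof -
  define \<kappa> where "\<kappa> = \<alpha> / (\<alpha> - s)"
  have \<kappa>: "1 < \<kappa>" and tc: "tail_const \<kappa> > 0"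
    using assms by (auto simp: \<kappa>_def field_simps intro!: tail_const_pos)
  have exps: "\<beta> / (\<alpha> - s) / \<beta> = 1 / (\<alpha> - s)" "\<alpha> * (\<beta> / (\<alpha> - s)) / \<beta> = \<kappa>" "(1 - \<kappa>) * (\<alpha> - s) = - s"
    using assms by (auto simp: \<kappa>_def field_simps)
  have "(\<integral>\<^sup>+t\<in>{..<y}. G t powe (\<beta> / (\<alpha> - s)) \<partial>M)
    \<le> (\<integral>\<^sup>+t. S powe (1 / (\<alpha> - s)) * (F t powe (- \<kappa>) * indicator {..<y} t) \<partial>M)"
    using G_powe_le[of \<alpha> \<beta> S "\<beta> / (\<alpha> - s)"] assms exps
    by (intro nn_integral_mono_AE) (auto split: split_indicator)
  also have "\<dots> = S powe (1 / (\<alpha> - s)) * (\<integral>\<^sup>+t\<in>{..<y}. F t powe (- \<kappa>) \<partial>M)"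
    by (simp add: nn_integral_cmult)
  also have "\<dots> \<le> S powe (1 / (\<alpha> - s)) * (tail_const \<kappa> * F y powe (1 - \<kappa>))"
    unfolding F_def by (intro mult_left_mono nn_integral_upper_tail_powe_le' \<kappa>) simp
  finally have "(\<integral>\<^sup>+t\<in>{..<y}. G t powe (\<beta> / (\<alpha> - s)) \<partial>M) powe (\<alpha> - s) * F y powe s
    \<le> (S powe (1 / (\<alpha> - s)) * (tail_const \<kappa> * F y powe (1 - \<kappa>))) powe (\<alpha> - s) * F y powe s"
    using assms by (intro mult_right_mono powe_mono) auto
  also have "\<dots> = tail_const \<kappa> powr (\<alpha> - s) * S * (F y powe (- s) * F y powe s)"
    using assms tc exps by (simp add: powe_mult powe_powe powe_ennreal mult_ac)
  also have "\<dots> \<le> tail_const \<kappa> powr (\<alpha> - s) * S * 1"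
    by (intro mult_left_mono powe_cancel_le) auto
  finally show ?thesis by (simp add: \<kappa>_def)
qed

text \<open>The outer exponent \<alpha> - s is negative, so the integral has to be bounded from
  below. The bound on F^\<alpha> G^\<beta> gives G^(\<beta>/(\<alpha> - s)) at least S^p F^(-
  \<alpha> p) with - \<alpha> p > 0, which is large where F is. Hence the integral is restricted to
  the set where F exceeds F(y) / 2, which carries at least half of the mass; the halving costs
  2^s.\<close>

lemma sup_bound_v:
  fixes S :: ennreal
  assumes S: "\<And>y. y \<in> I \<Longrightarrow> F y powe \<alpha> * G y powe \<beta> \<le> S"
    and "0 < \<alpha>" "0 < \<beta>" "0 < s" "\<alpha> < s" "y \<in> I"
  shows "(\<integral>\<^sup>+t\<in>{y<..}. G t powe (\<beta> / (\<alpha> - s)) \<partial>M) powe (\<alpha> - s) * F y powe s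
    \<le> ennreal (2 powr s) * S"
proof (cases "F y = 0")
  case True
  then show ?thesis using assms by (simp add: zero_powe)
next
  case False
  define p where "p = 1 / (\<alpha> - s)"
  define c where "c = F y / 2"
  have F2: "F y = 2 * c"
    unfolding c_def by (simp add: ennreal_times_divide mult_divide_eq_ennreal mult.commute[of 2])
  have p: "p < 0" using assms by (simp add: p_def)
  have c: "0 < c" "c < top"
    using False F_finite[OF \<open>y \<in> I\<close>]
    by (auto simp: c_def zero_less_iff_neq_zero less_top[symmetric] ennreal_divide_eq_top_iff)
  have exps: "\<beta> / (\<alpha> - s) / \<beta> = p" "\<alpha> * (\<beta> / (\<alpha> - s)) / \<beta> = \<alpha> * p" "p * (\<alpha> - s) = 1"
    "(1 - \<alpha> * p) * (\<alpha> - s) = - s"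
    using assms by (simp_all add: p_def divide_simps)
  define V where "V = {t. y < t \<and> c < F t}"
  have [measurable]: "V \<in> sets M"
  proof -
    have "{t \<in> space M. y < t \<and> c < F t} = {y<..} \<inter> {t \<in> space M. c < F t}"
      by (auto simp: space_eq_UNIV)
    also have "\<dots> \<in> sets M" by measurable
    finally show ?thesis by (simp add: space_eq_UNIV V_def)
  qed
  have "S powe p * c powe (1 - \<alpha> * p) = S powe p * c powe (- (\<alpha> * p)) * c"
    using powe_add[OF c, of "- (\<alpha> * p)" 1] by (simp add: mult.assoc)
  also have "\<dots> \<le> S powe p * c powe (- (\<alpha> * p)) * emeasure M V"
    using upper_half_mass[OF \<open>y \<in> I\<close>] by (intro mult_left_mono) (auto simp: V_def c_def)
  also have "\<dots> = (\<integral>\<^sup>+t\<in>V. S powe p * c powe (- (\<alpha> * p)) \<partial>M)"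
    by (simp add: nn_integral_cmult_indicator)
  also have "\<dots> \<le> (\<integral>\<^sup>+t\<in>{y<..}. G t powe (\<beta> / (\<alpha> - s)) \<partial>M)"
    using AE_I_F_pos
  proof (intro nn_integral_mono_AE, eventually_elim)
    case (elim t)
    have "S powe p * c powe (- (\<alpha> * p)) \<le> S powe p * F t powe (- (\<alpha> * p))" if "t \<in> V"
      using that p assms by (intro mult_left_mono powe_mono) (auto simp: V_def mult_le_0_iff)
    also have "\<dots> \<le> G t powe (\<beta> / (\<alpha> - s))"
      using powe_ge_of_mult_le[OF S, of t "\<beta> / (\<alpha> - s)"] elim assms F_finite[of t] exps
      by (simp add: divide_le_0_iff)
    finally show ?case
      by (auto simp: V_def split: split_indicator)
  qed
  finally have "(\<integral>\<^sup>+t\<in>{y<..}. G t powe (\<beta> / (\<alpha> - s)) \<partial>M) powe (\<alpha> - s) * F y powe s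
    \<le> (c powe (1 - \<alpha> * p) * S powe p) powe (\<alpha> - s) * F y powe s"
    using assms by (intro mult_right_mono powe_antimono) (auto simp: mult.commute)
  also have "\<dots> = S * (c powe (- s) * F y powe s)"
    unfolding powe_mult_pos[OF powe_pos_finite[OF c]] powe_powe exps(3,4) by (simp add: mult_ac)
  also have "\<dots> = S * 2 powe s * (c powe (- s) * c powe s)"
    using assms by (simp add: F2 powe_mult mult_ac)
  also have "\<dots> = ennreal (2 powr s) * S"
    using powe_neg_cancel(2)[OF c] powe_ennreal[of 2 s] by (simp add: mult.commute)
  finally show ?thesis .
qed

section \<open>Lower bounds for the right-hand sides\<close>

lemma lower_bound_i_ge:
  assumes "0 < \<alpha>" "0 < \<beta>" "0 < s" "s \<le> \<beta>" "y \<in> I"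
  shows "F y powe \<alpha> * G y powe \<beta>
    \<le> (\<integral>\<^sup>+t\<in>{y<..}. G t powe ((\<beta> - s) / \<alpha>) \<partial>M) powe \<alpha> * G y powe s"
proof -
  have "F y powe \<alpha> * G y powe \<beta> = F y powe \<alpha> * (G y powe (\<beta> - s) * G y powe s)"
    using powe_add_nonneg[of "\<beta> - s" s "G y"] assms by simp
  also have "\<dots> = (G y powe ((\<beta> - s) / \<alpha>) * F y) powe \<alpha> * G y powe s"
    using assms by (simp add: powe_mult powe_powe mult_ac)
  also have "\<dots> \<le> (\<integral>\<^sup>+t\<in>{y<..}. G t powe ((\<beta> - s) / \<alpha>) \<partial>M) powe \<alpha> * G y powe s"
    using assms by (intro mult_right_mono powe_mono const_mult_F_le G_mono) auto
  finally show ?thesis .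
qed

lemma lower_bound_iii:
  assumes "0 < \<alpha>" "0 < \<beta>" "0 < s" "y \<in> I"
  shows "F y powe \<alpha> * G y powe \<beta>
    \<le> (\<integral>\<^sup>+t\<in>{y<..}. G t powe (\<beta> / (\<alpha> + s)) \<partial>M) powe (\<alpha> + s) * F y powe (- s)"
proof (cases "F y = 0")
  case False
  have "F y powe \<alpha> * G y powe \<beta> = (G y powe (\<beta> / (\<alpha> + s)) * F y) powe (\<alpha> + s) * F y powe (- s)"
    using assms False powe_add[of "F y" "\<alpha> + s" "- s"] F_finite[of y]
    by (simp add: powe_mult powe_powe mult_ac zero_less_iff_neq_zero)
  also have "\<dots> \<le> (\<integral>\<^sup>+t\<in>{y<..}. G t powe (\<beta> / (\<alpha> + s)) \<partial>M) powe (\<alpha> + s) * F y powe (- s)"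
    using assms by (intro mult_right_mono powe_mono const_mult_F_le G_mono) auto
  finally show ?thesis .
qed (use assms in \<open>simp add: zero_powe\<close>)

text \<open>The integral extends to the left of the point while F is evaluated at it, so y has to be
  replaced by some z > y for which both F(z) and the mass of (y, z) are comparable to F(y). On (y,
  z) the weight is at least its value at y.\<close>

lemma lower_bound_iv:
  fixes R :: ennreal
  assumes R: "\<And>y. y \<in> I \<Longrightarrow>
      (\<integral>\<^sup>+t\<in>{..<y}. G t powe (\<beta> / (\<alpha> - s)) \<partial>M) powe (\<alpha> - s) * F y powe s \<le> R"
    and "0 < \<alpha>" "0 < \<beta>" "0 < s" "s < \<alpha>" "y \<in> I"
  shows "F y powe \<alpha> * G y powe \<beta> \<le> ennreal (4 powr \<alpha>) * R"
proof (cases "F y = 0")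
  case False
  \<comment> \<open>The points with F above F(y) / 2 carry mass at least 2 c; giving up c of it
    leaves a point z with more than c between y and z.\<close>
  define c where "c = F y / 4"
  have F4: "F y = 4 * c"
    unfolding c_def by (simp add: ennreal_times_divide mult_divide_eq_ennreal mult.commute[of 4])
  have c: "0 < c" "c < top"
    using False F_finite[OF \<open>y \<in> I\<close>]
    by (auto simp: c_def zero_less_iff_neq_zero less_top[symmetric] ennreal_divide_eq_top_iff)
  have "F y / 2 = (c + c) * 2 / 2"
    unfolding F4 by (rule arg_cong[where f = "\<lambda>z. z / 2"]) (simp add: mult_2 mult_2_right flip: mult_2)
  also have "\<dots> = c + c" by (rule mult_divide_eq_ennreal) auto
  finally have F2: "F y / 2 = c + c" .
  define V where "V = {t. t \<in> I \<and> y < t \<and> c + c < F t}"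
  \<comment> \<open>Otherwise all initial parts of the upper half would have mass at most c, hence
    so would the upper half itself, whose mass is at least c + c.\<close>
  have "\<exists>z\<in>V. c < emeasure M {y<..<z}"
  proof (rule ccontr)
    assume *: "\<not> (\<exists>z\<in>V. c < emeasure M {y<..<z})"
    define W where "W = {t. y < t \<and> c + c < F t}"
    have W [measurable]: "W \<in> sets M"
    proof -
      have "{t \<in> space M. y < t \<and> c + c < F t} = {y<..} \<inter> {t \<in> space M. c + c < F t}"
        by (auto simp: space_eq_UNIV)
      also have "\<dots> \<in> sets M" by measurable
      finally show ?thesis by (simp add: space_eq_UNIV W_def)
    qed
    \<comment> \<open>A null set covering the complement of I, removed so that the remaining points
      of W lie in V.\<close>
    obtain N where N: "N \<in> null_sets M" "- I \<subseteq> N"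
      using AE_I by (auto simp: eventually_ae_filter space_eq_UNIV)
    have WN: "W - N \<in> sets M" using N by auto
    have "emeasure M (W - N) \<le> c"
    proof (rule emeasure_le_of_lower_parts[OF borel_sets emeasure_singleton WN])
      fix w assume "w \<in> W - N"
      then have "w \<in> V" using N by (auto simp: W_def V_def)
      have "emeasure M ((W - N) \<inter> {..<w}) \<le> emeasure M {y<..<w}"
        using borel_sets by (intro emeasure_mono) (auto simp: W_def)
      also have "\<dots> \<le> c" using * \<open>w \<in> V\<close> by (auto simp: not_less)
      finally show "emeasure M ((W - N) \<inter> {..<w}) \<le> c" .
    qed
    then have "emeasure M W \<le> c"
      using N emeasure_Diff_null_set[OF N(1) W] by simp
    moreover have "c + c \<le> emeasure M W"
      using upper_half_mass[OF \<open>y \<in> I\<close>] by (simp add: F2 W_def)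
    ultimately have "c + c \<le> c + 0" unfolding add_0_right by (rule order.trans[rotated])
    then show False using c by (simp only: ennreal_add_left_cancel_le) auto
  qed
  then obtain z where z: "z \<in> I" "y < z" "c + c < F z" "c < emeasure M {y<..<z}"
    by (auto simp: V_def)
  have "c * G y powe (\<beta> / (\<alpha> - s)) \<le> emeasure M {y<..<z} * G y powe (\<beta> / (\<alpha> - s))"
    using z by (intro mult_right_mono) auto
  also have "\<dots> = (\<integral>\<^sup>+t\<in>{y<..<z}. G y powe (\<beta> / (\<alpha> - s)) \<partial>M)"
    using borel_sets by (subst nn_integral_cmult_indicator) (auto simp: mult.commute)
  also have "\<dots> \<le> (\<integral>\<^sup>+t\<in>{..<z}. G t powe (\<beta> / (\<alpha> - s)) \<partial>M)"
    using AE_I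
  proof (intro nn_integral_mono_AE, eventually_elim)
    case (elim t)
    then show ?case
      using assms by (auto split: split_indicator intro!: powe_mono G_mono)
  qed
  finally have int: "c * G y powe (\<beta> / (\<alpha> - s)) \<le> (\<integral>\<^sup>+t\<in>{..<z}. G t powe (\<beta> / (\<alpha> - s)) \<partial>M)" .
  have "F y powe \<alpha> * G y powe \<beta> = 4 powe \<alpha> * ((c * G y powe (\<beta> / (\<alpha> - s))) powe (\<alpha> - s) * c powe s)"
    using assms powe_add[OF c, of "\<alpha> - s" s] unfolding F4
    by (simp add: powe_mult powe_powe mult_ac)
  also have "\<dots> \<le> 4 powe \<alpha> * ((\<integral>\<^sup>+t\<in>{..<z}. G t powe (\<beta> / (\<alpha> - s)) \<partial>M) powe (\<alpha> - s) * F z powe s)"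
    using assms z int
    by (intro mult_left_mono mult_mono powe_mono) (auto intro: order.trans[of c "c + c"] less_imp_le)
  also have "\<dots> \<le> 4 powe \<alpha> * R"
    using R[OF z(1)] by (intro mult_left_mono) auto
  also have "\<dots> = ennreal (4 powr \<alpha>) * R"
    using powe_ennreal[of 4 \<alpha>] by simp
  finally show ?thesis .
qed (use assms in \<open>simp add: zero_powe\<close>)

text \<open>Both the exponent of G and the outer exponent are negative: the weight is at most its
  value at y, and the outer power reverses this into a lower bound.\<close>

lemma lower_bound_v:
  assumes "0 < \<alpha>" "0 < \<beta>" "0 < s" "\<alpha> < s" "y \<in> I"
  shows "F y powe \<alpha> * G y powe \<beta>
    \<le> (\<integral>\<^sup>+t\<in>{y<..}. G t powe (\<beta> / (\<alpha> - s)) \<partial>M) powe (\<alpha> - s) * F y powe s"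
proof (cases "F y = 0")
  case False
  then have Fpos: "0 < F y" "F y < top"
    using F_finite assms by (auto simp: zero_less_iff_neq_zero)
  have "F y powe \<alpha> * G y powe \<beta> = (F y * G y powe (\<beta> / (\<alpha> - s))) powe (\<alpha> - s) * F y powe s"
    using assms powe_add[OF Fpos, of "\<alpha> - s" s]
    by (simp add: powe_mult_pos[OF Fpos] powe_powe mult_ac)
  also have "\<dots> \<le> (\<integral>\<^sup>+t\<in>{y<..}. G t powe (\<beta> / (\<alpha> - s)) \<partial>M) powe (\<alpha> - s) * F y powe s"
  proof (intro mult_right_mono powe_antimono)
    show "(\<integral>\<^sup>+t\<in>{y<..}. G t powe (\<beta> / (\<alpha> - s)) \<partial>M) \<le> F y * G y powe (\<beta> / (\<alpha> - s))"
      unfolding mult.commute[of "F y"] using assms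
      by (intro le_const_mult_F powe_antimono G_mono) (auto simp: divide_le_0_iff)
  qed (use assms in auto)
  finally show ?thesis .
qed (use assms in \<open>simp add: zero_powe\<close>)

text \<open>Let N have density h^(-p) and tail H. Since h + G dominates both summands, the
  hypothesis yields H^\<alpha> h^s \<le> R on I as well as H^\<alpha> G^s \<le> R. Now F(y) is
  bounded by the integral of h^p against N; the first bound turns h^p into a power of R times
  H^(-\<kappa>), whose integral is at most a constant times H(y)^(1 - \<kappa>), and the second
  bound absorbs H(y) together with G(y).\<close>

lemma lower_bound_vi:
  fixes R :: ennreal
  assumes [measurable]: "h \<in> borel_measurable M" and h: "\<And>t. t \<in> I \<Longrightarrow> h t < top"
    and R: "\<And>y. y \<in> I \<Longrightarrow>
      (\<integral>\<^sup>+t\<in>{y<..}. h t powe ((\<beta> - s) / \<alpha>) \<partial>M) powe \<alpha> * (h y + G y) powe s \<le> R"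
    and "0 < \<alpha>" "0 < \<beta>" "0 < s" "\<beta> < s" "y \<in> I"
  shows "F y powe \<alpha> * G y powe \<beta> \<le> ennreal (tail_const ((s - \<beta>) / s) powr \<alpha>) * R"
proof (cases "R = top \<or> G y = 0")
  case True
  have "tail_const ((s - \<beta>) / s) > 0"
    using assms by (intro tail_const_pos) (auto simp: field_simps)
  then show ?thesis using True assms by (auto simp: ennreal_mult_top zero_powe)
next
  case False
  then have "R < top" "0 < G y" by (auto simp: less_top[symmetric] zero_less_iff_neq_zero)
  define \<kappa> p where "\<kappa> = (s - \<beta>) / s" and "p = (s - \<beta>) / \<alpha>"
  have \<kappa>: "0 \<le> \<kappa>" "\<kappa> < 1" and tc: "tail_const \<kappa> > 0" and p: "0 < p"
    using assms by (auto simp: \<kappa>_def p_def field_simps intro!: tail_const_pos)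
  have exps: "(\<beta> - s) / \<alpha> = - p" "\<alpha> * p / s = \<kappa>" "1 - \<kappa> = \<beta> / s" "p * \<alpha> = \<kappa> * s"
    using assms by (auto simp: \<kappa>_def p_def field_simps)
  define N where "N = density M (\<lambda>t. h t powe (- p))"
  interpret N: atomless_measure N
    unfolding N_def by (rule atomless_density) measurable
  define H where "H t = emeasure N {t<..}" for t
  have H: "H y powe \<alpha> * (h y + G y) powe s \<le> R" if "y \<in> I" for y
    using R[OF that] by (simp add: H_def N_def exps emeasure_density)
  have "H y powe \<alpha> * G y powe s \<le> H y powe \<alpha> * (h y + G y) powe s"
    using assms by (intro mult_left_mono powe_mono) auto
  also note H[OF \<open>y \<in> I\<close>]
  finally have HG: "H y powe \<alpha> * G y powe s \<le> R" .
  \<comment> \<open>An infinite tail would make the left side of HG infinite, because G(y) > 0,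
    against R < \<open>top\<close>.\<close>
  have "H y < top"
  proof (rule ccontr)
    assume "\<not> H y < top"
    then have "H y powe \<alpha> * G y powe s = top"
      using \<open>0 < G y\<close> assms by (simp add: top_powe ennreal_top_mult powe_eq_0_iff less_top[symmetric])
    with HG \<open>R < top\<close> show False by (simp add: top_unique)
  qed
  \<comment> \<open>Finiteness of the tail forces h > 0 almost everywhere to the right of y, so the
    density can be inverted there.\<close>
  then have "AE t in M. h t powe (- p) * indicator {y<..} t \<noteq> \<infinity>"
    by (intro nn_integral_PInf_AE) (auto simp: H_def N_def emeasure_density)
  then have "AE t in M. indicator {y<..} t \<le> h t powe (- p) * (h t powe p * indicator {y<..} t)"
    using AE_I
  proof eventually_elim
    case (elim t)
    show ?case
    proof (cases "y < t")
      case True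
      with elim p have "h t \<noteq> 0" by (auto simp: zero_powe)
      then have "h t powe (- p) * h t powe p = 1"
        using h[of t] elim by (intro powe_neg_cancel) (auto simp: zero_less_iff_neq_zero)
      then show ?thesis using True by simp
    qed simp
  qed
  then have "(\<integral>\<^sup>+t. indicator {y<..} t \<partial>M) \<le> (\<integral>\<^sup>+t. h t powe (- p) * (h t powe p * indicator {y<..} t) \<partial>M)"
    by (rule nn_integral_mono_AE)
  then have "F y \<le> (\<integral>\<^sup>+t. h t powe (- p) * (h t powe p * indicator {y<..} t) \<partial>M)"
    by (simp add: F_def)
  also have "\<dots> = (\<integral>\<^sup>+t\<in>{y<..}. h t powe p \<partial>N)"
    unfolding N_def by (rule nn_integral_density[symmetric]) measurable
  also have "\<dots> \<le> (\<integral>\<^sup>+t. R powe (p / s) * (H t powe (- \<kappa>) * indicator {y<..} t) \<partial>N)"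
  proof (rule nn_integral_mono_AE)
    have "AE t in N. t \<in> I" unfolding N_def by (subst AE_density) (use AE_I in auto)
    with N.AE_emeasure_greaterThan_pos
    show "AE t in N. h t powe p * indicator {y<..} t \<le> R powe (p / s) * (H t powe (- \<kappa>) * indicator {y<..} t)"
    proof eventually_elim
      case (elim t)
      show ?case
      proof (cases "y < t")
        case True
        then have "H t \<le> H y"
          unfolding H_def by (intro antimonoD[OF N.emeasure_greaterThan_antimono]) simp
        moreover have "H t powe \<alpha> * h t powe s \<le> R"
          using H[OF elim(2)] assms
          by (elim order.trans[rotated]) (auto intro!: mult_left_mono powe_mono)
        ultimately have "h t powe p \<le> R powe (p / s) * H t powe (- (\<alpha> * p / s))"
          using elim \<open>H y < top\<close> assms p by (intro powe_le_of_mult_le) (auto simp: H_def)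
        then show ?thesis using True exps by simp
      qed simp
    qed
  qed
  also have "\<dots> = R powe (p / s) * (\<integral>\<^sup>+t\<in>{y<..}. H t powe (- \<kappa>) \<partial>N)"
    unfolding H_def by (rule nn_integral_cmult) measurable
  also have "\<dots> \<le> R powe (p / s) * (tail_const \<kappa> * H y powe (1 - \<kappa>))"
    unfolding H_def by (intro mult_left_mono N.nn_integral_upper_tail_powe_le \<kappa>) simp
  finally have "F y powe \<alpha> * G y powe \<beta>
    \<le> (R powe (p / s) * (tail_const \<kappa> * H y powe (\<beta> / s))) powe \<alpha> * G y powe \<beta>"
    using assms exps by (intro mult_right_mono powe_mono) auto
  also have "\<dots> = tail_const \<kappa> powr \<alpha> * (R powe \<kappa> * (H y powe \<alpha> * G y powe s) powe (\<beta> / s))"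
    using assms tc exps by (simp add: powe_mult powe_powe powe_ennreal mult_ac)
  also have "\<dots> \<le> tail_const \<kappa> powr \<alpha> * (R powe \<kappa> * R powe (\<beta> / s))"
    using assms by (intro mult_left_mono powe_mono HG) auto
  also have "R powe \<kappa> * R powe (\<beta> / s) = R"
    using assms \<kappa> exps by (intro powe_split_1) auto
  finally show ?thesis by (simp add: \<kappa>_def)
qed

text \<open>Now N has density (h + G)^q, and K is its mass to the left. F(y) is bounded by the
  integral of (h + G)^(-q) against N over \<open>{y<..}\<close>. There the integrand is at most
  G(y)^(-q) by monotonicity of G, and at most h^(-q), hence a power of R times K^(-\<kappa>), by the
  hypothesis. Integrating the minimum leaves G(y)^(-\<beta>) R after the outer power.\<close>

lemma lower_bound_vii:
  fixes R :: ennreal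
  assumes [measurable]: "h \<in> borel_measurable M" and h: "\<And>t. t \<in> I \<Longrightarrow> h t < top"
    and R: "\<And>y. y \<in> I \<Longrightarrow>
      h y powe (- s) * (\<integral>\<^sup>+t\<in>{..<y}. (h t + G t) powe ((\<beta> + s) / \<alpha>) \<partial>M) powe \<alpha> \<le> R"
    and "0 < \<alpha>" "0 < \<beta>" "0 < s" "y \<in> I"
  shows "F y powe \<alpha> * G y powe \<beta> \<le> ennreal ((1 + tail_const ((\<beta> + s) / s)) powr \<alpha>) * R"
proof (cases "R = top \<or> G y = 0")
  case True
  have "tail_const ((\<beta> + s) / s) > 0"
    using assms by (intro tail_const_pos) (auto simp: field_simps)
  then show ?thesis using True assms by (auto simp: ennreal_mult_top zero_powe)
next
  case False
  then have "R < top" and Gpos: "0 < G y" "G y < top"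
    using G_finite assms by (auto simp: less_top[symmetric] zero_less_iff_neq_zero)
  define \<kappa> q where "\<kappa> = (\<beta> + s) / s" and "q = (\<beta> + s) / \<alpha>"
  have \<kappa>: "1 < \<kappa>" and tc: "tail_const \<kappa> > 0" and q: "0 < q"
    using assms by (auto simp: \<kappa>_def q_def field_simps intro!: tail_const_pos)
  have exps: "\<alpha> * q / s = \<kappa>" "q * (1 - 1 / \<kappa>) * \<alpha> = \<beta>" "q / s * (1 / \<kappa>) * \<alpha> = 1"
    using assms \<kappa> by (simp_all add: \<kappa>_def q_def divide_simps)
  define w where "w t = (h t + G t) powe q" for t
  have [measurable]: "w \<in> borel_measurable M" unfolding w_def by measurable
  define N where "N = density M w"
  interpret N: atomless_measure N
    unfolding N_def by (rule atomless_density) measurable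
  define K where "K t = emeasure N {..<t}" for t
  have K: "K y powe \<alpha> * h y powe (- s) \<le> R" if "y \<in> I" for y
    using R[OF that] by (simp add: K_def N_def w_def q_def emeasure_density mult.commute)
  have "AE t in M. indicator {y<..} t \<le> w t * ((h t + G t) powe (- q) * indicator {y<..} t)"
    using AE_I
  proof eventually_elim
    case (elim t)
    show ?case
    proof (cases "y < t")
      case True
      then have "0 < G t"
        using elim G_mono[of y t] Gpos(1) \<open>y \<in> I\<close> by (intro less_le_trans[OF Gpos(1)]) auto
      then have "0 < h t + G t" "h t + G t < top"
        using elim h[of t] G_finite[of t] by (auto simp: zero_less_iff_neq_zero)
      then have "w t * (h t + G t) powe (- q) = 1"
        unfolding w_def by (rule powe_neg_cancel)
      then show ?thesis using True by simp
    qed simp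
  qed
  then have "(\<integral>\<^sup>+t. indicator {y<..} t \<partial>M) \<le> (\<integral>\<^sup>+t. w t * ((h t + G t) powe (- q) * indicator {y<..} t) \<partial>M)"
    by (rule nn_integral_mono_AE)
  then have "F y \<le> (\<integral>\<^sup>+t. w t * ((h t + G t) powe (- q) * indicator {y<..} t) \<partial>M)"
    by (simp add: F_def)
  also have "\<dots> = (\<integral>\<^sup>+t\<in>{y<..}. (h t + G t) powe (- q) \<partial>N)"
    unfolding N_def by (rule nn_integral_density[symmetric]) measurable
  also have "\<dots> \<le> (\<integral>\<^sup>+t. min (G y powe (- q)) (R powe (q / s) * K t powe (- \<kappa>)) \<partial>N)"
  proof (rule nn_integral_mono_AE)
    have "AE t in N. t \<in> I" unfolding N_def by (subst AE_density) (use AE_I in auto)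
    with N.AE_emeasure_lessThan_pos
    show "AE t in N. (h t + G t) powe (- q) * indicator {y<..} t
        \<le> min (G y powe (- q)) (R powe (q / s) * K t powe (- \<kappa>))"
    proof eventually_elim
      case (elim t)
      show ?case
      proof (cases "y < t")
        case True
        have "G y \<le> h t + G t"
          using G_mono[of y t] True elim assms by (auto intro: add_increasing)
        then have "(h t + G t) powe (- q) \<le> G y powe (- q)"
          using q by (intro powe_antimono) auto
        moreover have "(h t + G t) powe (- q) \<le> R powe (q / s) * K t powe (- \<kappa>)"
        proof -
          \<comment> \<open>As h(t) is finite, its negative power is nonzero, and an infinite K(t)
            would make R infinite.\<close>
          have "K t < top"
          proof (rule ccontr)
            assume "\<not> K t < top"
            then have "K t powe \<alpha> * h t powe (- s) = top"
              using h[of t] elim assms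
              by (simp add: top_powe ennreal_top_mult powe_eq_0_iff less_top[symmetric])
            with K[OF elim(2)] \<open>R < top\<close> show False by (simp add: top_unique)
          qed
          have "(h t + G t) powe (- q) \<le> h t powe (- q)"
            using q by (intro powe_antimono) auto
          \<comment> \<open>With 1 / h as the unknown, the hypothesis is a bound on K^\<alpha> (1 /
            h)^s with positive exponents.\<close>
          also have "\<dots> = (h t powe (- 1)) powe q" by (simp add: powe_powe)
          also have "\<dots> \<le> R powe (q / s) * K t powe (- (\<alpha> * q / s))"
            using K[OF elim(2)] \<open>K t < top\<close> elim assms q
            by (intro powe_le_of_mult_le) (auto simp: K_def powe_powe)
          finally show ?thesis using exps by simp
        qed
        ultimately show ?thesis using True by simp
      qed simp
    qed
  qed
  also have "\<dots> \<le> ennreal (1 + tail_const \<kappa>) *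
      ((G y powe (- q)) powe (1 - 1 / \<kappa>) * (R powe (q / s)) powe (1 / \<kappa>))"
    unfolding K_def using Gpos \<open>R < top\<close> assms q \<kappa>
    by (intro N.nn_integral_min_lower_tail_le)
       (auto simp: powe_eq_top_iff divide_less_0_iff simp flip: less_top)
  finally have "F y powe \<alpha> * G y powe \<beta> \<le>
      (ennreal (1 + tail_const \<kappa>) * ((G y powe (- q)) powe (1 - 1 / \<kappa>) * (R powe (q / s)) powe (1 / \<kappa>))) powe \<alpha>
        * G y powe \<beta>"
    using assms by (intro mult_right_mono powe_mono) auto
  also have "\<dots> = ennreal ((1 + tail_const \<kappa>) powr \<alpha>) * R * (G y powe (- \<beta>) * G y powe \<beta>)"
    using assms tc q exps by (simp add: powe_mult powe_powe powe_ennreal mult_ac del: ennreal_plus)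
  also have "\<dots> = ennreal ((1 + tail_const \<kappa>) powr \<alpha>) * R"
    using powe_neg_cancel(2)[OF Gpos] by simp
  finally show ?thesis by (simp add: \<kappa>_def)
qed

end

subsection \<open>The equivalences for suprema over the right interval\<close>

text \<open>Moving the constant to the side of A lets a bound be proved for each h separately and
  then passed to the infimum over h.\<close>

lemma le_const_mult_iff:
  assumes "c > 0"
  shows "A \<le> ennreal c * B \<longleftrightarrow> ennreal (1 / c) * A \<le> B"
proof -
  have c: "ennreal c * ennreal (1 / c) = 1" "ennreal (1 / c) * ennreal c = 1"
    using assms by (simp_all flip: ennreal_mult)
  show ?thesis
  proof
    assume "A \<le> ennreal c * B"
    then have "ennreal (1 / c) * A \<le> ennreal (1 / c) * (ennreal c * B)" by (rule mult_left_mono) simp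
    then show "ennreal (1 / c) * A \<le> B" using c by (simp flip: mult.assoc)
  next
    assume "ennreal (1 / c) * A \<le> B"
    then have "ennreal c * (ennreal (1 / c) * A) \<le> ennreal c * B" by (rule mult_left_mono) simp
    then show "A \<le> ennreal c * B" using c by (simp flip: mult.assoc)
  qed
qed

lemma equivalentI:
  assumes "c > 0" "d > 0"
    and "\<And>a b f g x. admissible a b f g x \<Longrightarrow> A a b f g x \<le> ennreal c * B a b f g x"
    and "\<And>a b f g x. admissible a b f g x \<Longrightarrow> B a b f g x \<le> ennreal d * A a b f g x"
  shows "equivalent A B"
  unfolding equivalent_def
  using assms le_const_mult_iff[OF assms(1)] by (intro exI[of _ "1 / c"] exI[of _ d]) auto

lemma Mplus_measurable_extend:
  assumes "h \<in> Mplus a b"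
  shows "(\<lambda>t. if t \<in> einterval a b then h t else 0) \<in> borel_measurable lebesgue"
  using assms by (subst borel_measurable_if) (auto simp: Mplus_def)

lemma lower_int_mono: "mono (lower_int a g)"
  unfolding lower_int_def
  by (intro monoI nn_integral_mono)
     (auto simp: einterval_iff split: split_indicator intro: less_le_trans)

section \<open>From integrals over intervals to tails of a measure\<close>

locale admissible_data =
  fixes a b :: ereal and f g :: "real \<Rightarrow> real" and x :: real
  assumes admissible: "admissible a b f g x"
begin

abbreviation I :: "real set" where
  "I \<equiv> einterval (ereal x) b"

abbreviation G :: "real \<Rightarrow> ennreal" where
  "G \<equiv> lower_int a g"

text \<open>The density is cut off outside (x, b), not (a, b), so that \<open>{..<y}\<close> has the
  meaning of (x, y) as in (ii), (iv) and (vii).\<close>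

definition \<mu> :: "real measure" where
  "\<mu> = density lebesgue (\<lambda>t. ennreal (f t) * indicator I t)"

lemma I_subset: "I \<subseteq> einterval a b"
proof
  fix t assume "t \<in> I"
  moreover have "a < ereal x" using admissible by (simp add: admissible_def einterval_iff)
  ultimately show "t \<in> einterval a b"
    using less_trans[of a "ereal x" "ereal t"] by (simp add: einterval_iff)
qed

lemma density_measurable [measurable]:
  "(\<lambda>t. ennreal (f t) * indicator I t) \<in> borel_measurable lebesgue"
proof -
  have "f \<in> Mplus a b" using admissible by (simp add: admissible_def)
  note f = Mplus_measurable_extend[OF this]
  have "(\<lambda>t. ennreal (f t) * indicator I t)
      = (\<lambda>t. ennreal (if t \<in> einterval a b then f t else 0) * indicator I t)"
    using I_subset by (auto simp: fun_eq_iff split: split_indicator)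
  also have "\<dots> \<in> borel_measurable lebesgue"
    by (intro borel_measurable_times_ennreal measurable_compose[OF f measurable_ennreal]
        borel_measurable_indicator) simp
  finally show ?thesis .
qed

lemma sets_\<mu> [simp, measurable_cong]: "sets \<mu> = sets lebesgue"
  by (simp add: \<mu>_def)

lemma G_measurable: "G \<in> borel_measurable lebesgue"
  using borel_measurable_mono_ennreal[OF lower_int_mono[of a g]]
  by (intro measurable_completion) simp

text \<open>Two integrands appear because a competitor h is unconstrained outside (a, b): H is the
  expression as stated, H' a version measurable on the whole line that agrees with it on (x,
  b).\<close>

lemma nn_integral_upper_eq:
  assumes "y \<in> I" and H: "\<And>t. t \<in> I \<Longrightarrow> H t = H' t" and H': "H' \<in> borel_measurable lebesgue"
  shows "(\<integral>\<^sup>+t\<in>einterval (ereal y) b. ennreal (f t) * H t \<partial>lebesgue) = (\<integral>\<^sup>+t\<in>{y<..}. H' t \<partial>\<mu>)"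
proof -
  have "(\<integral>\<^sup>+t\<in>{y<..}. H' t \<partial>\<mu>)
      = (\<integral>\<^sup>+t. ennreal (f t) * indicator I t * (H' t * indicator {y<..} t) \<partial>lebesgue)"
    unfolding \<mu>_def using H'
    by (intro nn_integral_density density_measurable borel_measurable_times_ennreal borel_measurable_indicator) auto
  also have "\<dots> = (\<integral>\<^sup>+t\<in>einterval (ereal y) b. ennreal (f t) * H t \<partial>lebesgue)"
    using \<open>y \<in> I\<close> H
    by (intro nn_integral_cong) (auto simp: einterval_iff split: split_indicator intro: less_trans)
  finally show ?thesis by simp
qed

lemma nn_integral_lower_eq:
  assumes "y \<in> I" and H: "\<And>t. t \<in> I \<Longrightarrow> H t = H' t" and H': "H' \<in> borel_measurable lebesgue"
  shows "(\<integral>\<^sup>+t\<in>{x<..<y}. ennreal (f t) * H t \<partial>lebesgue) = (\<integral>\<^sup>+t\<in>{..<y}. H' t \<partial>\<mu>)"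
proof -
  have "(\<integral>\<^sup>+t\<in>{..<y}. H' t \<partial>\<mu>)
      = (\<integral>\<^sup>+t. ennreal (f t) * indicator I t * (H' t * indicator {..<y} t) \<partial>lebesgue)"
    unfolding \<mu>_def using H'
    by (intro nn_integral_density density_measurable borel_measurable_times_ennreal borel_measurable_indicator) auto
  also have "\<dots> = (\<integral>\<^sup>+t\<in>{x<..<y}. ennreal (f t) * H t \<partial>lebesgue)"
    using \<open>y \<in> I\<close> H
    by (intro nn_integral_cong) (auto simp: einterval_iff split: split_indicator intro: less_trans[of _ "ereal y"])
  finally show ?thesis by simp
qed

lemma upper_int_eq:
  assumes "y \<in> I"
  shows "upper_int b f y = emeasure \<mu> {y<..}"
  using nn_integral_upper_eq[OF assms, of "\<lambda>_. 1" "\<lambda>_. 1"] by (simp add: upper_int_def)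

sublocale weighted_tail \<mu> I G
proof unfold_locales
  show "sets borel \<subseteq> sets \<mu>" by (auto intro: sets_completionI_sets)
  fix t :: real
  have "{t} \<in> null_sets lebesgue" by (auto simp: null_sets_def)
  then have "{t} \<in> null_sets \<mu>"
    using absolutely_continuousI_density[OF density_measurable]
    unfolding absolutely_continuous_def \<mu>_def by (rule subsetD[rotated])
  then show "emeasure \<mu> {t} = 0" by (rule null_setsD1)
next
  show "AE t in \<mu>. t \<in> I"
    unfolding \<mu>_def by (subst AE_density) (auto split: split_indicator)
next
  fix y assume "y \<in> I"
  then show "emeasure \<mu> {y<..} < top"
    using admissible I_subset by (auto simp: admissible_def simp flip: upper_int_eq)
next
  show "G \<in> borel_measurable \<mu>"
    using G_measurable by (simp add: \<mu>_def)
next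
  fix y t :: real assume "y \<le> t"
  then show "G y \<le> G t" by (rule monoD[OF lower_int_mono])
next
  fix y assume "y \<in> I"
  then show "G y < top"
    using admissible I_subset by (auto simp: admissible_def)
qed

lemma sup_right_eq: "sup_right \<alpha> \<beta> a b f g x = (SUP y\<in>I. F y powe \<alpha> * G y powe \<beta>)"
  unfolding sup_right_def by (intro SUP_cong) (auto simp: upper_int_eq F_def)

lemma F_G_le_sup_right: "y \<in> I \<Longrightarrow> F y powe \<alpha> * G y powe \<beta> \<le> sup_right \<alpha> \<beta> a b f g x"
  unfolding sup_right_eq by (rule SUP_upper)

lemma upper_int_eq_F: "y \<in> I \<Longrightarrow> upper_int b f y = F y"
  by (simp add: upper_int_eq F_def)

lemma nn_integral_upper_G:
  "y \<in> I \<Longrightarrow> (\<integral>\<^sup>+t\<in>einterval (ereal y) b. ennreal (f t) * G t powe r \<partial>lebesgue)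
    = (\<integral>\<^sup>+t\<in>{y<..}. G t powe r \<partial>\<mu>)"
  by (rule nn_integral_upper_eq) (use G_measurable in \<open>auto intro: measurable_powe\<close>)

lemma nn_integral_lower_G:
  "y \<in> I \<Longrightarrow> (\<integral>\<^sup>+t\<in>{x<..<y}. ennreal (f t) * G t powe r \<partial>lebesgue)
    = (\<integral>\<^sup>+t\<in>{..<y}. G t powe r \<partial>\<mu>)"
  by (rule nn_integral_lower_eq) (use G_measurable in \<open>auto intro: measurable_powe\<close>)

definition restr :: "(real \<Rightarrow> real) \<Rightarrow> real \<Rightarrow> ennreal" where
  "restr h t = ennreal (if t \<in> einterval a b then h t else 0)"

lemma restr_measurable:
  assumes "h \<in> Mplus a b"
  shows "restr h \<in> borel_measurable lebesgue"
  unfolding restr_def using Mplus_measurable_extend[OF assms] by measurable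

lemma restr_measurable_\<mu>:
  assumes "h \<in> Mplus a b"
  shows "restr h \<in> borel_measurable \<mu>"
  using restr_measurable[OF assms] by (simp add: \<mu>_def)

lemma restr_eq: "t \<in> I \<Longrightarrow> restr h t = ennreal (h t)"
  using I_subset by (auto simp: restr_def)

lemma restr_finite: "restr h t < top"
  by (simp add: restr_def)

text \<open>G itself is the competitor that bounds the infima over h from above.\<close>

lemma enn2real_G_Mplus: "(\<lambda>t. enn2real (G t)) \<in> Mplus a b"
  using G_measurable by (auto simp: Mplus_def intro!: measurable_restrict_space1)

lemma enn2real_G: "t \<in> I \<Longrightarrow> ennreal (enn2real (G t)) = G t"
  using G_finite by simp

lemma nn_integral_upper_h:
  assumes "y \<in> I" "h \<in> Mplus a b"
  shows "(\<integral>\<^sup>+t\<in>einterval (ereal y) b. ennreal (f t) * ennreal (h t) powe r \<partial>lebesgue)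
    = (\<integral>\<^sup>+t\<in>{y<..}. restr h t powe r \<partial>\<mu>)"
  using assms restr_measurable[OF assms(2)]
  by (intro nn_integral_upper_eq) (auto simp: restr_eq intro: measurable_powe)

lemma nn_integral_lower_h:
  assumes "y \<in> I" "h \<in> Mplus a b"
  shows "(\<integral>\<^sup>+t\<in>{x<..<y}. ennreal (f t) * (ennreal (h t) + G t) powe r \<partial>lebesgue)
    = (\<integral>\<^sup>+t\<in>{..<y}. (restr h t + G t) powe r \<partial>\<mu>)"
  using assms restr_measurable[OF assms(2)] G_measurable
  by (intro nn_integral_lower_eq) (auto simp: restr_eq intro!: measurable_powe)

end

text \<open>Some of the lower bounds at y use a bound R valid at all points of J; R becomes the
  supremum of U.\<close>

lemma le_const_mult_SUP:
  fixes T :: "'i \<Rightarrow> ennreal"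
  assumes "\<And>y R. y \<in> J \<Longrightarrow> (\<And>z. z \<in> J \<Longrightarrow> U z \<le> R) \<Longrightarrow> T y \<le> c * R"
  shows "(SUP y\<in>J. T y) \<le> c * (SUP y\<in>J. U y)"
  using assms by (intro SUP_least) (auto intro: SUP_upper)

section \<open>The equivalences (i)--(vii)\<close>

lemma equivalent_i:
  assumes "0 < \<alpha>" "0 < \<beta>" "0 < s"
  shows "equivalent (sup_right \<alpha> \<beta>)
       (\<lambda>a b f g x.
          SUP y\<in>einterval (ereal x) b.
            (\<integral>\<^sup>+ t\<in>einterval (ereal y) b. ennreal (f t) * lower_int a g t powe ((\<beta> - s) / \<alpha>) \<partial>lebesgue)
              powe \<alpha> * lower_int a g y powe s)"
proof (cases "s \<le> \<beta>")
  case True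
  show ?thesis
  proof (rule equivalentI[of 1 "tail_const ((\<beta> - s) / \<beta>) powr \<alpha>"])
    show "0 < tail_const ((\<beta> - s) / \<beta>) powr \<alpha>"
      using assms tail_const_pos[of "(\<beta> - s) / \<beta>"] by (simp add: field_simps)
    fix a b f g x assume "admissible a b f g x"
    then interpret admissible_data a b f g x by unfold_locales
    show "sup_right \<alpha> \<beta> a b f g x \<le> ennreal 1 * (SUP y\<in>I.
            (\<integral>\<^sup>+ t\<in>einterval (ereal y) b. ennreal (f t) * G t powe ((\<beta> - s) / \<alpha>) \<partial>lebesgue)
              powe \<alpha> * G y powe s)"
      unfolding sup_right_eq using True assms
      by (auto simp: nn_integral_upper_G intro!: SUP_subset_mono lower_bound_i_ge)
    show "(SUP y\<in>I. (\<integral>\<^sup>+ t\<in>einterval (ereal y) b. ennreal (f t) * G t powe ((\<beta> - s) / \<alpha>) \<partial>lebesgue)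
              powe \<alpha> * G y powe s) \<le> ennreal (tail_const ((\<beta> - s) / \<beta>) powr \<alpha>) * sup_right \<alpha> \<beta> a b f g x"
      using True assms
      by (intro SUP_least) (simp add: nn_integral_upper_G sup_bound_i_ge F_G_le_sup_right)
  qed simp
next
  case False
  have tc: "0 < tail_const ((s - \<beta>) / s) powr \<alpha>"
    using assms tail_const_pos[of "(s - \<beta>) / s"] by (simp add: field_simps)
  show ?thesis
  proof (rule equivalentI[of "tail_const ((s - \<beta>) / s) powr \<alpha> * 2 powr s" 1])
    fix a b f g x assume "admissible a b f g x"
    then interpret admissible_data a b f g x by unfold_locales
    \<comment> \<open>The lower bound is the one for arbitrary h, taken at h = G; doubling G costs
      2^s.\<close>
    have eq: "(G y + G y) powe s = 2 powr s * G y powe s" for y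
      using powe_mult[of s 2 "G y"] powe_ennreal[of 2 s] assms by (simp add: mult_2)
    show "sup_right \<alpha> \<beta> a b f g x \<le> ennreal (tail_const ((s - \<beta>) / s) powr \<alpha> * 2 powr s) * (SUP y\<in>I.
            (\<integral>\<^sup>+ t\<in>einterval (ereal y) b. ennreal (f t) * G t powe ((\<beta> - s) / \<alpha>) \<partial>lebesgue)
              powe \<alpha> * G y powe s)"
      unfolding sup_right_eq
    proof (rule le_const_mult_SUP)
      fix y R
      assume "y \<in> I" and R: "\<And>z. z \<in> I \<Longrightarrow>
         (\<integral>\<^sup>+ t\<in>einterval (ereal z) b. ennreal (f t) * G t powe ((\<beta> - s) / \<alpha>) \<partial>lebesgue)
              powe \<alpha> * G z powe s \<le> R"
      have "F y powe \<alpha> * G y powe \<beta> \<le> ennreal (tail_const ((s - \<beta>) / s) powr \<alpha>) * (2 powr s * R)"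
      proof (rule lower_bound_vi[OF _ G_finite])
        fix z assume "z \<in> I"
        have "2 powr s * ((\<integral>\<^sup>+ t\<in>{z<..}. G t powe ((\<beta> - s) / \<alpha>) \<partial>\<mu>) powe \<alpha> * G z powe s) \<le> 2 powr s * R"
          using R[OF \<open>z \<in> I\<close>] \<open>z \<in> I\<close> by (intro mult_left_mono) (simp_all add: nn_integral_upper_G)
        then show "(\<integral>\<^sup>+ t\<in>{z<..}. G t powe ((\<beta> - s) / \<alpha>) \<partial>\<mu>) powe \<alpha> * (G z + G z) powe s \<le> 2 powr s * R"
          by (simp add: eq mult_ac)
      qed (use assms False \<open>y \<in> I\<close> in auto)
      then show "F y powe \<alpha> * G y powe \<beta> \<le> ennreal (tail_const ((s - \<beta>) / s) powr \<alpha> * 2 powr s) * R"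
        by (simp add: ennreal_mult mult.assoc)
    qed
    show "(SUP y\<in>I. (\<integral>\<^sup>+ t\<in>einterval (ereal y) b. ennreal (f t) * G t powe ((\<beta> - s) / \<alpha>) \<partial>lebesgue)
              powe \<alpha> * G y powe s) \<le> ennreal 1 * sup_right \<alpha> \<beta> a b f g x"
      unfolding sup_right_eq using False assms
      by (auto simp: nn_integral_upper_G intro!: SUP_subset_mono sup_bound_i_less)
  qed (use tc in auto)
qed

lemma equivalent_ii:
  assumes "0 < \<alpha>" "0 < \<beta>" "0 < s"
  shows "equivalent (sup_right \<alpha> \<beta>)
       (\<lambda>a b f g x.
          SUP y\<in>einterval (ereal x) b.
            (\<integral>\<^sup>+ t\<in>{x<..<y}. ennreal (f t) * lower_int a g t powe ((\<beta> + s) / \<alpha>) \<partial>lebesgue)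
              powe \<alpha> * lower_int a g y powe (- s))"
proof -
  let ?c = "(1 + tail_const ((\<beta> + s) / s)) powr \<alpha> * 2 powr (\<beta> + s)"
    and ?d = "(1 + tail_const ((\<beta> + s) / \<beta>)) powr \<alpha>"
  have tc: "0 < tail_const ((\<beta> + s) / s)" "0 < tail_const ((\<beta> + s) / \<beta>)"
    using assms by (auto simp: field_simps intro!: tail_const_pos)
  show ?thesis
  proof (rule equivalentI[of ?c ?d])
    fix a b f g x assume "admissible a b f g x"
    then interpret admissible_data a b f g x by unfold_locales
    let ?U = "\<lambda>y. (\<integral>\<^sup>+ t\<in>{x<..<y}. ennreal (f t) * G t powe ((\<beta> + s) / \<alpha>) \<partial>lebesgue) powe \<alpha> * G y powe (- s)"
    \<comment> \<open>Again h = G in the bound for arbitrary h. The doubling now occurs inside the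
      integral, and the outer power \<alpha> turns its factor into 2^(\<beta> + s).\<close>
    have eq: "(G y + G y) powe ((\<beta> + s) / \<alpha>) = 2 powr ((\<beta> + s) / \<alpha>) * G y powe ((\<beta> + s) / \<alpha>)" for y
      using powe_mult[of "(\<beta> + s) / \<alpha>" 2 "G y"] powe_ennreal[of 2 "(\<beta> + s) / \<alpha>"] assms
      by (simp add: mult_2)
    show "sup_right \<alpha> \<beta> a b f g x \<le> ennreal ?c * (SUP y\<in>I. ?U y)"
      unfolding sup_right_eq
    proof (rule le_const_mult_SUP)
      fix y R assume "y \<in> I" and R: "\<And>z. z \<in> I \<Longrightarrow> ?U z \<le> R"
      have "F y powe \<alpha> * G y powe \<beta>
        \<le> ennreal ((1 + tail_const ((\<beta> + s) / s)) powr \<alpha>) * (ennreal (2 powr (\<beta> + s)) * R)"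
      proof (rule lower_bound_vii[OF _ G_finite])
        fix z assume "z \<in> I"
        have "(\<integral>\<^sup>+ t\<in>{..<z}. (G t + G t) powe ((\<beta> + s) / \<alpha>) \<partial>\<mu>)
            = 2 powr ((\<beta> + s) / \<alpha>) * (\<integral>\<^sup>+ t\<in>{..<z}. G t powe ((\<beta> + s) / \<alpha>) \<partial>\<mu>)"
          by (simp add: eq mult.assoc nn_integral_cmult)
        then have "G z powe (- s) * (\<integral>\<^sup>+ t\<in>{..<z}. (G t + G t) powe ((\<beta> + s) / \<alpha>) \<partial>\<mu>) powe \<alpha>
            = 2 powr (\<beta> + s) * ?U z"
          unfolding nn_integral_lower_G[OF \<open>z \<in> I\<close>] using assms
          by (simp add: powe_mult powe_ennreal powr_powr mult_ac)
        also have "\<dots> \<le> 2 powr (\<beta> + s) * R"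
          using R[OF \<open>z \<in> I\<close>] by (intro mult_left_mono) auto
        finally show "G z powe (- s) * (\<integral>\<^sup>+ t\<in>{..<z}. (G t + G t) powe ((\<beta> + s) / \<alpha>) \<partial>\<mu>) powe \<alpha>
            \<le> 2 powr (\<beta> + s) * R" .
      qed (use assms \<open>y \<in> I\<close> in auto)
      then show "F y powe \<alpha> * G y powe \<beta> \<le> ennreal ?c * R"
        by (simp add: ennreal_mult mult.assoc)
    qed
    show "(SUP y\<in>I. ?U y) \<le> ennreal ?d * sup_right \<alpha> \<beta> a b f g x"
      using assms
      by (intro SUP_least) (simp add: nn_integral_lower_G sup_bound_ii F_G_le_sup_right)
  qed (use tc in auto)
qed

lemma equivalent_iii:
  assumes "0 < \<alpha>" "0 < \<beta>" "0 < s"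
  shows "equivalent (sup_right \<alpha> \<beta>)
       (\<lambda>a b f g x.
          SUP y\<in>einterval (ereal x) b.
            (\<integral>\<^sup>+ t\<in>einterval (ereal y) b. ennreal (f t) * lower_int a g t powe (\<beta> / (\<alpha> + s)) \<partial>lebesgue)
              powe (\<alpha> + s) * upper_int b f y powe (- s))"
proof -
  let ?d = "tail_const (\<alpha> / (\<alpha> + s)) powr (\<alpha> + s)"
  have tc: "0 < tail_const (\<alpha> / (\<alpha> + s))"
    using assms by (auto simp: field_simps intro!: tail_const_pos)
  show ?thesis
  proof (rule equivalentI[of 1 ?d])
    fix a b f g x assume "admissible a b f g x"
    then interpret admissible_data a b f g x by unfold_locales
    let ?U = "\<lambda>y. (\<integral>\<^sup>+ t\<in>einterval (ereal y) b. ennreal (f t) * G t powe (\<beta> / (\<alpha> + s)) \<partial>lebesgue)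
              powe (\<alpha> + s) * upper_int b f y powe (- s)"
    show "sup_right \<alpha> \<beta> a b f g x \<le> ennreal 1 * (SUP y\<in>I. ?U y)"
      unfolding sup_right_eq using assms
      by (auto simp: nn_integral_upper_G upper_int_eq_F intro!: SUP_subset_mono lower_bound_iii)
    show "(SUP y\<in>I. ?U y) \<le> ennreal ?d * sup_right \<alpha> \<beta> a b f g x"
      using assms
      by (intro SUP_least) (simp add: nn_integral_upper_G upper_int_eq_F sup_bound_iii F_G_le_sup_right)
  qed (use tc in auto)
qed

lemma equivalent_iv:
  assumes "0 < \<alpha>" "0 < \<beta>" "0 < s" "s < \<alpha>"
  shows "equivalent (sup_right \<alpha> \<beta>)
       (\<lambda>a b f g x.
          SUP y\<in>einterval (ereal x) b.
            (\<integral>\<^sup>+ t\<in>{x<..<y}. ennreal (f t) * lower_int a g t powe (\<beta> / (\<alpha> - s)) \<partial>lebesgue)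
              powe (\<alpha> - s) * upper_int b f y powe s)"
proof -
  let ?d = "tail_const (\<alpha> / (\<alpha> - s)) powr (\<alpha> - s)"
  have tc: "0 < tail_const (\<alpha> / (\<alpha> - s))"
    using assms by (auto simp: field_simps intro!: tail_const_pos)
  show ?thesis
  proof (rule equivalentI[of "4 powr \<alpha>" ?d])
    fix a b f g x assume "admissible a b f g x"
    then interpret admissible_data a b f g x by unfold_locales
    let ?U = "\<lambda>y. (\<integral>\<^sup>+ t\<in>{x<..<y}. ennreal (f t) * G t powe (\<beta> / (\<alpha> - s)) \<partial>lebesgue)
              powe (\<alpha> - s) * upper_int b f y powe s"
    show "sup_right \<alpha> \<beta> a b f g x \<le> ennreal (4 powr \<alpha>) * (SUP y\<in>I. ?U y)"
      unfolding sup_right_eq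
      by (rule le_const_mult_SUP, rule lower_bound_iv)
         (use assms in \<open>auto simp: nn_integral_lower_G upper_int_eq_F\<close>)
    show "(SUP y\<in>I. ?U y) \<le> ennreal ?d * sup_right \<alpha> \<beta> a b f g x"
      using assms
      by (intro SUP_least) (simp add: nn_integral_lower_G upper_int_eq_F sup_bound_iv F_G_le_sup_right)
  qed (use tc in auto)
qed

lemma equivalent_v:
  assumes "0 < \<alpha>" "0 < \<beta>" "0 < s" "\<alpha> < s"
  shows "equivalent (sup_right \<alpha> \<beta>)
       (\<lambda>a b f g x.
          SUP y\<in>einterval (ereal x) b.
            (\<integral>\<^sup>+ t\<in>einterval (ereal y) b. ennreal (f t) * lower_int a g t powe (\<beta> / (\<alpha> - s)) \<partial>lebesgue)
              powe (\<alpha> - s) * upper_int b f y powe s)"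
proof (rule equivalentI[of 1 "2 powr s"])
  fix a b f g x assume "admissible a b f g x"
  then interpret admissible_data a b f g x by unfold_locales
  let ?U = "\<lambda>y. (\<integral>\<^sup>+ t\<in>einterval (ereal y) b. ennreal (f t) * G t powe (\<beta> / (\<alpha> - s)) \<partial>lebesgue)
            powe (\<alpha> - s) * upper_int b f y powe s"
  show "sup_right \<alpha> \<beta> a b f g x \<le> ennreal 1 * (SUP y\<in>I. ?U y)"
    unfolding sup_right_eq using assms
    by (auto simp: nn_integral_upper_G upper_int_eq_F intro!: SUP_subset_mono lower_bound_v)
  show "(SUP y\<in>I. ?U y) \<le> ennreal (2 powr s) * sup_right \<alpha> \<beta> a b f g x"
    using assms
    by (intro SUP_least) (simp add: nn_integral_upper_G upper_int_eq_F sup_bound_v F_G_le_sup_right)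
qed auto

lemma equivalent_vi:
  assumes "0 < \<alpha>" "0 < \<beta>" "0 < s" "\<beta> < s"
  shows "equivalent (sup_right \<alpha> \<beta>)
       (\<lambda>a b f g x.
          INF h\<in>Mplus a b. SUP y\<in>einterval (ereal x) b.
            (\<integral>\<^sup>+ t\<in>einterval (ereal y) b. ennreal (f t) * ennreal (h t) powe ((\<beta> - s) / \<alpha>) \<partial>lebesgue)
              powe \<alpha> * (ennreal (h y) + lower_int a g y) powe s)"
proof -
  let ?c = "tail_const ((s - \<beta>) / s) powr \<alpha>"
  have tc: "0 < ?c"
    using assms tail_const_pos[of "(s - \<beta>) / s"] by (simp add: field_simps)
  show ?thesis
  proof (rule equivalentI[of ?c "2 powr s"])
    fix a b f g x assume "admissible a b f g x"
    then interpret admissible_data a b f g x by unfold_locales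
    let ?U = "\<lambda>h y. (\<integral>\<^sup>+ t\<in>einterval (ereal y) b. ennreal (f t) * ennreal (h t) powe ((\<beta> - s) / \<alpha>) \<partial>lebesgue)
              powe \<alpha> * (ennreal (h y) + G y) powe s"
    show "sup_right \<alpha> \<beta> a b f g x \<le> ennreal ?c * (INF h\<in>Mplus a b. SUP y\<in>I. ?U h y)"
      unfolding le_const_mult_iff[OF tc]
    proof (rule INF_greatest, unfold le_const_mult_iff[OF tc, symmetric])
      fix h assume h: "h \<in> Mplus a b"
      show "sup_right \<alpha> \<beta> a b f g x \<le> ennreal ?c * (SUP y\<in>I. ?U h y)"
        unfolding sup_right_eq
      proof (rule le_const_mult_SUP)
        fix y R assume "y \<in> I" and R: "\<And>z. z \<in> I \<Longrightarrow> ?U h z \<le> R"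
        show "F y powe \<alpha> * G y powe \<beta> \<le> ennreal ?c * R"
          using assms \<open>y \<in> I\<close> R
          by (intro lower_bound_vi[OF restr_measurable_\<mu>[OF h] restr_finite])
             (auto simp: nn_integral_upper_h[OF _ h] restr_eq)
      qed
    qed
    \<comment> \<open>The competitor h = G reduces the upper bound to that of (i) for \<beta> < s,
      up to 2^s.\<close>
    have "(INF h\<in>Mplus a b. SUP y\<in>I. ?U h y) \<le> (SUP y\<in>I. ?U (\<lambda>t. enn2real (G t)) y)"
      by (rule INF_lower) (rule enn2real_G_Mplus)
    also have "\<dots> \<le> ennreal (2 powr s) * sup_right \<alpha> \<beta> a b f g x"
    proof (rule SUP_least)
      fix y assume y: "y \<in> I"
      have "(\<integral>\<^sup>+ t\<in>einterval (ereal y) b. ennreal (f t) * ennreal (enn2real (G t)) powe ((\<beta> - s) / \<alpha>) \<partial>lebesgue)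
          = (\<integral>\<^sup>+ t\<in>{y<..}. G t powe ((\<beta> - s) / \<alpha>) \<partial>\<mu>)"
        using y G_measurable by (intro nn_integral_upper_eq) (auto simp: enn2real_G intro: measurable_powe)
      moreover have "(G y + G y) powe s = 2 powr s * G y powe s"
        using powe_mult[of s 2 "G y"] powe_ennreal[of 2 s] assms by (simp add: mult_2)
      ultimately have "?U (\<lambda>t. enn2real (G t)) y
          = 2 powr s * ((\<integral>\<^sup>+ t\<in>{y<..}. G t powe ((\<beta> - s) / \<alpha>) \<partial>\<mu>) powe \<alpha> * G y powe s)"
        using y by (simp add: enn2real_G mult_ac)
      also have "\<dots> \<le> 2 powr s * sup_right \<alpha> \<beta> a b f g x"
        using assms y
        by (intro mult_left_mono order.trans[OF sup_bound_i_less F_G_le_sup_right]) auto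
      finally show "?U (\<lambda>t. enn2real (G t)) y \<le> ennreal (2 powr s) * sup_right \<alpha> \<beta> a b f g x" .
    qed
    finally show "(INF h\<in>Mplus a b. SUP y\<in>I. ?U h y) \<le> ennreal (2 powr s) * sup_right \<alpha> \<beta> a b f g x" .
  qed (use tc in auto)
qed

lemma equivalent_vii:
  assumes "0 < \<alpha>" "0 < \<beta>" "0 < s"
  shows "equivalent (sup_right \<alpha> \<beta>)
       (\<lambda>a b f g x.
          INF h\<in>Mplus a b. SUP y\<in>einterval (ereal x) b.
            ennreal (h y) powe (- s) * (\<integral>\<^sup>+ t\<in>{x<..<y}. ennreal (f t) * (ennreal (h t) + lower_int a g t) powe ((\<beta> + s) / \<alpha>) \<partial>lebesgue)
              powe \<alpha>)"
proof -
  let ?c = "(1 + tail_const ((\<beta> + s) / s)) powr \<alpha>"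
    and ?d = "(1 + tail_const ((\<beta> + s) / \<beta>)) powr \<alpha>"
  have "0 < tail_const ((\<beta> + s) / s)" "0 < tail_const ((\<beta> + s) / \<beta>)"
    using assms by (auto simp: field_simps intro!: tail_const_pos)
  then have tc: "0 < ?c" "0 < ?d * 2 powr (\<beta> + s)" by auto
  show ?thesis
  proof (rule equivalentI[OF tc])
    fix a b f g x assume "admissible a b f g x"
    then interpret admissible_data a b f g x by unfold_locales
    let ?q = "(\<beta> + s) / \<alpha>"
    let ?U = "\<lambda>h y. ennreal (h y) powe (- s) * (\<integral>\<^sup>+ t\<in>{x<..<y}. ennreal (f t) * (ennreal (h t) + G t) powe ?q \<partial>lebesgue)
              powe \<alpha>"
    show "sup_right \<alpha> \<beta> a b f g x \<le> ennreal ?c * (INF h\<in>Mplus a b. SUP y\<in>I. ?U h y)"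
      unfolding le_const_mult_iff[OF tc(1)]
    proof (rule INF_greatest, unfold le_const_mult_iff[OF tc(1), symmetric])
      fix h assume h: "h \<in> Mplus a b"
      show "sup_right \<alpha> \<beta> a b f g x \<le> ennreal ?c * (SUP y\<in>I. ?U h y)"
        unfolding sup_right_eq
      proof (rule le_const_mult_SUP)
        fix y R assume "y \<in> I" and R: "\<And>z. z \<in> I \<Longrightarrow> ?U h z \<le> R"
        show "F y powe \<alpha> * G y powe \<beta> \<le> ennreal ?c * R"
          using assms \<open>y \<in> I\<close> R
          by (intro lower_bound_vii[OF restr_measurable_\<mu>[OF h] restr_finite])
             (auto simp: nn_integral_lower_h[OF _ h] restr_eq)
      qed
    qed
    have eq: "(G t + G t) powe ?q = 2 powr ?q * G t powe ?q" for t
      using powe_mult[of ?q 2 "G t"] powe_ennreal[of 2 ?q] assms by (simp add: mult_2)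
    \<comment> \<open>The competitor h = G reduces the upper bound to that of (ii), up to 2^(\<beta>
      + s).\<close>
    have "(INF h\<in>Mplus a b. SUP y\<in>I. ?U h y) \<le> (SUP y\<in>I. ?U (\<lambda>t. enn2real (G t)) y)"
      by (rule INF_lower) (rule enn2real_G_Mplus)
    also have "\<dots> \<le> ennreal (?d * 2 powr (\<beta> + s)) * sup_right \<alpha> \<beta> a b f g x"
    proof (rule SUP_least)
      fix y assume y: "y \<in> I"
      have "(\<integral>\<^sup>+ t\<in>{x<..<y}. ennreal (f t) * (ennreal (enn2real (G t)) + G t) powe ?q \<partial>lebesgue)
          = (\<integral>\<^sup>+ t\<in>{..<y}. 2 powr ?q * G t powe ?q \<partial>\<mu>)"
        using y G_measurable by (intro nn_integral_lower_eq) (auto simp: enn2real_G eq intro!: measurable_powe)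
      also have "\<dots> = 2 powr ?q * (\<integral>\<^sup>+ t\<in>{..<y}. G t powe ?q \<partial>\<mu>)"
        by (simp add: mult.assoc nn_integral_cmult)
      finally have "?U (\<lambda>t. enn2real (G t)) y
          = 2 powr (\<beta> + s) * ((\<integral>\<^sup>+ t\<in>{..<y}. G t powe ?q \<partial>\<mu>) powe \<alpha> * G y powe (- s))"
        using y assms by (simp add: enn2real_G powe_mult powe_ennreal powr_powr mult_ac)
      also have "\<dots> \<le> 2 powr (\<beta> + s) * (?d * sup_right \<alpha> \<beta> a b f g x)"
        using assms y by (intro mult_left_mono sup_bound_ii F_G_le_sup_right) auto
      finally show "?U (\<lambda>t. enn2real (G t)) y \<le> ennreal (?d * 2 powr (\<beta> + s)) * sup_right \<alpha> \<beta> a b f g x"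
        by (simp add: ennreal_mult mult_ac)
    qed
    finally show "(INF h\<in>Mplus a b. SUP y\<in>I. ?U h y) \<le> ennreal (?d * 2 powr (\<beta> + s)) * sup_right \<alpha> \<beta> a b f g x" .
  qed
qed

subsection \<open>Reflection\<close>

text \<open>The integrand is arbitrary so that reflection can act as a rewrite rule without
  measurability side conditions. The integral is a supremum over simple functions below the
  integrand, and these can be reflected; applying the inequality to u and to its reflection gives
  equality.\<close>

lemma nn_integral_lebesgue_reflect:
  fixes u :: "real \<Rightarrow> ennreal"
  shows "(\<integral>\<^sup>+t. u (- t) \<partial>lebesgue) = (\<integral>\<^sup>+t. u t \<partial>lebesgue)"
proof -
  have le: "(\<integral>\<^sup>+t. v t \<partial>lebesgue) \<le> (\<integral>\<^sup>+t. v (- t) \<partial>lebesgue)" for v :: "real \<Rightarrow> ennreal"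
    unfolding nn_integral_def[of lebesgue v]
  proof (rule SUP_least)
    fix w assume "w \<in> {w. simple_function lebesgue w \<and> w \<le> v}"
    then have w: "simple_function lebesgue w" "w \<le> v" by auto
    have "integral\<^sup>S lebesgue w = (\<integral>\<^sup>+t. w t \<partial>lebesgue)"
      using w by (simp add: nn_integral_eq_simple_integral)
    also have "\<dots> = (\<integral>\<^sup>+t. w (- t) \<partial>lebesgue)"
      using nn_integral_real_affine_lebesgue[of w "-1" 0] w by (simp add: borel_measurable_simple_function)
    also have "\<dots> \<le> (\<integral>\<^sup>+t. v (- t) \<partial>lebesgue)"
      using w by (intro nn_integral_mono) (simp add: le_fun_def)
    finally show "integral\<^sup>S lebesgue w \<le> (\<integral>\<^sup>+t. v (- t) \<partial>lebesgue)" .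
  qed
  show ?thesis
    using le[of u] le[of "\<lambda>t. u (- t)"] by (auto intro: antisym)
qed

lemma einterval_reflect: "- t \<in> einterval (- b) (- a) \<longleftrightarrow> t \<in> einterval a b"
  by (cases a; cases b) (auto simp: einterval_iff)

lemma nn_integral_einterval_reflect:
  "(\<integral>\<^sup>+t\<in>einterval (- b) (- a). u t \<partial>lebesgue) = (\<integral>\<^sup>+t\<in>einterval a b. u (- t) \<partial>lebesgue)"
  by (subst nn_integral_lebesgue_reflect[symmetric]) (simp add: indicator_def einterval_reflect)

lemma nn_integral_greaterThanLessThan_reflect:
  "(\<integral>\<^sup>+t\<in>{- x<..<- y}. u t \<partial>lebesgue) = (\<integral>\<^sup>+t\<in>{y<..<x}. u (- t) \<partial>lebesgue)" for x y :: real
  using nn_integral_einterval_reflect[of u "ereal x" "ereal y"] by simp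

lemma SUP_einterval_reflect:
  fixes U :: "real \<Rightarrow> ennreal"
  shows "(SUP y\<in>einterval (- b) (- a). U y) = (SUP y\<in>einterval a b. U (- y))"
proof -
  have "einterval (- b) (- a) = uminus ` einterval a b"
  proof (intro equalityI subsetI)
    fix t assume "t \<in> einterval (- b) (- a)"
    then show "t \<in> uminus ` einterval a b"
      using einterval_reflect[of "- t" b a] by (intro image_eqI[of _ _ "- t"]) auto
  qed (auto simp: einterval_reflect)
  then show ?thesis by (simp add: image_image)
qed

lemma Mplus_reflect_mem:
  assumes "h \<in> Mplus a b"
  shows "(\<lambda>t. h (- t)) \<in> Mplus (- b) (- a)"
proof -
  let ?h = "\<lambda>t. if t \<in> einterval a b then h t else 0"
  have "(\<lambda>t. ?h (- t)) \<in> borel_measurable lebesgue"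
    using measurable_compose[OF lebesgue_measurable_scaling[of "-1"] Mplus_measurable_extend[OF assms]]
    by (simp cong: if_cong)
  moreover have "(\<lambda>t. ?h (- t)) = (\<lambda>t. if t \<in> einterval (- b) (- a) then h (- t) else 0)"
    using einterval_reflect[of "- _" a b] by (intro ext) (metis einterval_reflect ereal_uminus_uminus minus_minus)
  ultimately have "(\<lambda>t. h (- t)) \<in> borel_measurable (lebesgue_on (einterval (- b) (- a)))"
    by (intro borel_measurable_if_D) simp
  moreover have "0 \<le> h (- t)" if "t \<in> einterval (- b) (- a)" for t
    using assms that einterval_reflect[of "- t" b a] by (simp add: Mplus_def)
  ultimately show ?thesis by (simp add: Mplus_def)
qed

lemma INF_Mplus_reflect:
  fixes U :: "(real \<Rightarrow> real) \<Rightarrow> ennreal"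
  shows "(INF h\<in>Mplus (- b) (- a). U h) = (INF h\<in>Mplus a b. U (\<lambda>t. h (- t)))"
proof -
  have "Mplus (- b) (- a) = (\<lambda>h t. h (- t)) ` Mplus a b"
  proof (intro equalityI subsetI)
    fix h assume "h \<in> Mplus (- b) (- a)"
    from Mplus_reflect_mem[OF this] show "h \<in> (\<lambda>h t. h (- t)) ` Mplus a b"
      by (intro image_eqI[of _ _ "\<lambda>t. h (- t)"]) auto
  qed (auto intro: Mplus_reflect_mem)
  then show ?thesis by (simp add: image_image)
qed

section \<open>Reflected data and transfer of the equivalences\<close>

lemma lower_int_reflect: "lower_int (- b) (\<lambda>t. f (- t)) (- y) = upper_int b f y"
  using nn_integral_einterval_reflect[of "\<lambda>t. ennreal (f (- t))" b "ereal y"]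
  by (simp add: lower_int_def upper_int_def)

lemma upper_int_reflect: "upper_int (- a) (\<lambda>t. g (- t)) (- y) = lower_int a g y"
  using nn_integral_einterval_reflect[of "\<lambda>t. ennreal (g (- t))" "ereal y" a]
  by (simp add: lower_int_def upper_int_def)

lemma admissible_reflect:
  assumes "admissible a b f g x"
  shows "admissible (- b) (- a) (\<lambda>t. g (- t)) (\<lambda>t. f (- t)) (- x)"
proof -
  have "upper_int (- a) (\<lambda>t. g (- t)) y < top \<and> lower_int (- b) (\<lambda>t. f (- t)) y < top"
    if "y \<in> einterval (- b) (- a)" for y
  proof -
    have "- y \<in> einterval a b" using that einterval_reflect[of "- y" b a] by simp
    then show ?thesis
      using assms upper_int_reflect[of a g "- y"] lower_int_reflect[of b f "- y"]
      by (simp add: admissible_def)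
  qed
  then show ?thesis
    using assms by (auto simp: admissible_def einterval_reflect intro: Mplus_reflect_mem)
qed

lemma sup_left_reflect:
  "sup_left \<alpha> \<beta> a b f g x = sup_right \<beta> \<alpha> (- b) (- a) (\<lambda>t. g (- t)) (\<lambda>t. f (- t)) (- x)"
  unfolding sup_left_def sup_right_def
  using SUP_einterval_reflect[where b = "ereal x" and a = a] by (simp add: upper_int_reflect lower_int_reflect mult.commute)

text \<open>The constants in \<open>equivalent\<close> precede the data, so they remain valid for
  the reflected data, in which f and g, and with them \<alpha> and \<beta>, change places.\<close>

lemma equivalent_reflect:
  assumes "equivalent (sup_right \<beta> \<alpha>) B"
    and "\<And>a b f g x. B' a b f g x = B (- b) (- a) (\<lambda>t. g (- t)) (\<lambda>t. f (- t)) (- x)"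
  shows "equivalent (sup_left \<alpha> \<beta>) B'"
proof -
  obtain c1 c2 where "c1 > 0" "c2 > 0" and "\<And>a b f g x. admissible a b f g x \<Longrightarrow>
      ennreal c1 * sup_right \<beta> \<alpha> a b f g x \<le> B a b f g x \<and>
      B a b f g x \<le> ennreal c2 * sup_right \<beta> \<alpha> a b f g x"
    using assms(1) by (auto simp: equivalent_def)
  then show ?thesis
    unfolding equivalent_def assms(2) sup_left_reflect
    by (intro exI[of _ c1] exI[of _ c2]) (simp add: admissible_reflect)
qed

text \<open>The instances at \<open>ereal x\<close> are simplified so that their left sides contain
  \<open>ereal (- x)\<close>, the form in which the reflected endpoint occurs.\<close>

lemmas reflect_simps =
  SUP_einterval_reflect[where b = "ereal x" for x, simplified]
  nn_integral_einterval_reflect[where b = "ereal x" for x, simplified]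
  nn_integral_greaterThanLessThan_reflect INF_Mplus_reflect
  lower_int_reflect upper_int_reflect

theorem theorem2p1:
  fixes \<alpha> \<beta> s :: real
  assumes "\<alpha> > 0" and "\<beta> > 0" and "s > 0"
  shows
    "(equivalent (sup_right \<alpha> \<beta>)
       (\<lambda>a b f g x.
          SUP y\<in>einterval (ereal x) b.
            (\<integral>\<^sup>+ t\<in>einterval (ereal y) b. ennreal (f t) * lower_int a g t powe ((\<beta> - s) / \<alpha>) \<partial>lebesgue)
              powe \<alpha> * lower_int a g y powe s)) \<and>
     (equivalent (sup_right \<alpha> \<beta>)
       (\<lambda>a b f g x.
          SUP y\<in>einterval (ereal x) b.
            (\<integral>\<^sup>+ t\<in>{x<..<y}. ennreal (f t) * lower_int a g t powe ((\<beta> + s) / \<alpha>) \<partial>lebesgue)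
              powe \<alpha> * lower_int a g y powe (- s))) \<and>
     (equivalent (sup_right \<alpha> \<beta>)
       (\<lambda>a b f g x.
          SUP y\<in>einterval (ereal x) b.
            (\<integral>\<^sup>+ t\<in>einterval (ereal y) b. ennreal (f t) * lower_int a g t powe (\<beta> / (\<alpha> + s)) \<partial>lebesgue)
              powe (\<alpha> + s) * upper_int b f y powe (- s))) \<and>
     (s < \<alpha> \<longrightarrow> equivalent (sup_right \<alpha> \<beta>)
       (\<lambda>a b f g x.
          SUP y\<in>einterval (ereal x) b.
            (\<integral>\<^sup>+ t\<in>{x<..<y}. ennreal (f t) * lower_int a g t powe (\<beta> / (\<alpha> - s)) \<partial>lebesgue)
              powe (\<alpha> - s) * upper_int b f y powe s)) \<and>
     (\<alpha> < s \<longrightarrow> equivalent (sup_right \<alpha> \<beta>)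
       (\<lambda>a b f g x.
          SUP y\<in>einterval (ereal x) b.
            (\<integral>\<^sup>+ t\<in>einterval (ereal y) b. ennreal (f t) * lower_int a g t powe (\<beta> / (\<alpha> - s)) \<partial>lebesgue)
              powe (\<alpha> - s) * upper_int b f y powe s)) \<and>
     (\<beta> < s \<longrightarrow> equivalent (sup_right \<alpha> \<beta>)
       (\<lambda>a b f g x.
          INF h\<in>Mplus a b. SUP y\<in>einterval (ereal x) b.
            (\<integral>\<^sup>+ t\<in>einterval (ereal y) b. ennreal (f t) * ennreal (h t) powe ((\<beta> - s) / \<alpha>) \<partial>lebesgue)
              powe \<alpha> * (ennreal (h y) + lower_int a g y) powe s)) \<and>
     (equivalent (sup_right \<alpha> \<beta>)
       (\<lambda>a b f g x.
          INF h\<in>Mplus a b. SUP y\<in>einterval (ereal x) b.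
            ennreal (h y) powe (- s) * (\<integral>\<^sup>+ t\<in>{x<..<y}. ennreal (f t) * (ennreal (h t) + lower_int a g t) powe ((\<beta> + s) / \<alpha>) \<partial>lebesgue)
              powe \<alpha>)) \<and>
     (equivalent (sup_left \<alpha> \<beta>)
       (\<lambda>a b f g x.
          SUP y\<in>einterval a (ereal x).
            (\<integral>\<^sup>+ t\<in>einterval a (ereal y). ennreal (g t) * upper_int b f t powe ((\<alpha> - s) / \<beta>) \<partial>lebesgue)
              powe \<beta> * upper_int b f y powe s)) \<and>
     (equivalent (sup_left \<alpha> \<beta>)
       (\<lambda>a b f g x.
          SUP y\<in>einterval a (ereal x).
            (\<integral>\<^sup>+ t\<in>{y<..<x}. ennreal (g t) * upper_int b f t powe ((\<alpha> + s) / \<beta>) \<partial>lebesgue)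
              powe \<beta> * upper_int b f y powe (- s))) \<and>
     (equivalent (sup_left \<alpha> \<beta>)
       (\<lambda>a b f g x.
          SUP y\<in>einterval a (ereal x).
            (\<integral>\<^sup>+ t\<in>einterval a (ereal y). ennreal (g t) * upper_int b f t powe (\<alpha> / (\<beta> + s)) \<partial>lebesgue)
              powe (\<beta> + s) * lower_int a g y powe (- s))) \<and>
     (s < \<beta> \<longrightarrow> equivalent (sup_left \<alpha> \<beta>)
       (\<lambda>a b f g x.
          SUP y\<in>einterval a (ereal x).
            (\<integral>\<^sup>+ t\<in>{y<..<x}. ennreal (g t) * upper_int b f t powe (\<alpha> / (\<beta> - s)) \<partial>lebesgue)
              powe (\<beta> - s) * lower_int a g y powe s)) \<and>
     (\<beta> < s \<longrightarrow> equivalent (sup_left \<alpha> \<beta>)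
       (\<lambda>a b f g x.
          SUP y\<in>einterval a (ereal x).
            (\<integral>\<^sup>+ t\<in>einterval a (ereal y). ennreal (g t) * upper_int b f t powe (\<alpha> / (\<beta> - s)) \<partial>lebesgue)
              powe (\<beta> - s) * lower_int a g y powe s)) \<and>
     (\<alpha> < s \<longrightarrow> equivalent (sup_left \<alpha> \<beta>)
       (\<lambda>a b f g x.
          INF h\<in>Mplus a b. SUP y\<in>einterval a (ereal x).
            (\<integral>\<^sup>+ t\<in>einterval a (ereal y). ennreal (g t) * ennreal (h t) powe ((\<alpha> - s) / \<beta>) \<partial>lebesgue)
              powe \<beta> * (ennreal (h y) + upper_int b f y) powe s)) \<and>
     (equivalent (sup_left \<alpha> \<beta>)
       (\<lambda>a b f g x.
          INF h\<in>Mplus a b. SUP y\<in>einterval a (ereal x).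
            ennreal (h y) powe (- s) * (\<integral>\<^sup>+ t\<in>{y<..<x}. ennreal (g t) * (ennreal (h t) + upper_int b f t) powe ((\<alpha> + s) / \<beta>) \<partial>lebesgue)
              powe \<beta>))"
  (is "?i \<and> ?ii \<and> ?iii \<and> (_ \<longrightarrow> ?iv) \<and> (_ \<longrightarrow> ?v) \<and> (_ \<longrightarrow> ?vi) \<and> ?vii \<and>
    ?viii \<and> ?ix \<and> ?x \<and> (_ \<longrightarrow> ?xi) \<and> (_ \<longrightarrow> ?xii) \<and> (_ \<longrightarrow> ?xiii) \<and> ?xiv")
proof (intro conjI impI)
  show ?i ?ii ?iii ?vii
    using assms by (rule equivalent_i equivalent_ii equivalent_iii equivalent_vii)+
  show ?iv if "s < \<alpha>" using assms that by (rule equivalent_iv)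
  show ?v if "\<alpha> < s" using assms that by (rule equivalent_v)
  show ?vi if "\<beta> < s" using assms that by (rule equivalent_vi)
  note swapped = assms(2,1,3)
  show ?viii
    by (rule equivalent_reflect[OF equivalent_i[OF swapped]]) (simp add: reflect_simps)
  show ?ix
    by (rule equivalent_reflect[OF equivalent_ii[OF swapped]]) (simp add: reflect_simps)
  show ?x
    by (rule equivalent_reflect[OF equivalent_iii[OF swapped]]) (simp add: reflect_simps)
  show ?xi if "s < \<beta>"
    by (rule equivalent_reflect[OF equivalent_iv[OF swapped that]]) (simp add: reflect_simps)
  show ?xii if "\<beta> < s"
    by (rule equivalent_reflect[OF equivalent_v[OF swapped that]]) (simp add: reflect_simps)
  show ?xiii if "\<alpha> < s"
    by (rule equivalent_reflect[OF equivalent_vi[OF swapped that]]) (simp add: reflect_simps)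
  show ?xiv
    by (rule equivalent_reflect[OF equivalent_vii[OF swapped]]) (simp add: reflect_simps)
qed

end
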